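(* Let $n_\infty\in[n_1,n_2)$, $s_+=-s_->0$, and $$\kappa_0=-\frac{\mathrm i}{2s_+n_2}\ln\frac{n_2+n_\infty}{n_2-n_\infty}+\frac{\pi}{(s_+-s_-)n_2}.$$ Then the function $$\varepsilon_0(s)=\begin{cases}n_2^2,&s\in[s_-,s_+],\\ n_\infty^2,&s\in\mathbb R\setminus[s_-,s_+],\end{cases}$$ is the unique minimizer of $\operatorname{arg\,min}_{\varepsilon\in\mathbb F^{\mathrm{sym}},\ \kappa_0\in\Sigma^{\mathrm{odd}}(\varepsilon)}L(\varepsilon)$, and the corresponding minimal value of $L(\varepsilon)$ is $L^{\mathrm{odd}}_{\min}(\kappa_0)=2s_+$.
   Context: Fix constants $0<n_1<n_2$. $\mathbb F^{\mathrm{sym}}$ is the family of positive $\varepsilon\in L^\infty(\mathbb R;\mathbb R)$ with $\varepsilon(s)=\varepsilon(-s)$ a.e. for which there exist real $a_-\le a_+$ with $\varepsilon(s)=n_\infty^2$ for a.a. $s\in\mathbb R\setminus[a_-,a_+]$ and $n_1^2\le\varepsilon(s)\le n_2^2$ for a.a. $s\in(a_-,a_+)$. If $\varepsilon$ is not the constant $n_\infty^2$, $[s_-^\varepsilon,s_+^\varepsilon]$ is the shortest interval outside of which $\varepsilon=n_\infty^2$ a.e., and $L(\varepsilon)=s_+^\varepsilon-s_-^\varepsilon$; if $\varepsilon\equiv n_\infty^2$, then $L(\varepsilon)=0$. $\Sigma^{\mathrm{odd}}(\varepsilon)$ is the set of $\kappa\in\mathbb C\setminus\{0\}$ for which there is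 a nontrivial odd $y\in W^{2,\infty}_{\mathrm{loc}}(\mathbb R)$ with $y''=-\kappa^2\varepsilon y$ a.e. on $\mathbb R$ and $y'(a_\pm)/\kappa=\pm\mathrm i n_\infty y(a_\pm)$, where $\varepsilon=n_\infty^2$ a.e. outside $[a_-,a_+]$. $L^{\mathrm{odd}}_{\min}(\kappa)=\inf\{L(\varepsilon):\varepsilon\in\mathbb F^{\mathrm{sym}},\ \kappa\in\Sigma^{\mathrm{odd}}(\varepsilon)\}$. Uniqueness is understood in the sense of $L^\infty$-equivalence classes. *)

theory Defs
  imports "HOL-Analysis.Analysis"
begin

text \<open>
  Elements of \<open>L\<^sup>\<infinity>\<close> are represented by functions defined everywhere; equality of classes is
  equality almost everywhere with respect to Lebesgue measure.
\<close>

definition Linf :: "(real \<Rightarrow> 'a::euclidean_space) \<Rightarrow> bool" where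
  "Linf f \<longleftrightarrow> f \<in> borel_measurable lebesgue \<and> (\<exists>C. AE s in lebesgue. norm (f s) \<le> C)"

definition Linf_loc :: "(real \<Rightarrow> 'a::euclidean_space) \<Rightarrow> bool" where
  "Linf_loc f \<longleftrightarrow> f \<in> borel_measurable lebesgue \<and>
     (\<forall>a b. \<exists>C. AE s in lebesgue. s \<in> {a..b} \<longrightarrow> norm (f s) \<le> C)"

text \<open>
  \<open>W1inf_loc u v\<close>: \<open>u\<close> is the (locally absolutely) continuous representative of a function in
  \<open>W\<^sup>1\<^sup>,\<^sup>\<infinity>\<^sub>l\<^sub>o\<^sub>c(\<real>)\<close> with derivative \<open>v\<close>, an element of \<open>L\<^sup>\<infinity>\<^sub>l\<^sub>o\<^sub>c(\<real>)\<close>.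
\<close>

definition W1inf_loc :: "(real \<Rightarrow> complex) \<Rightarrow> (real \<Rightarrow> complex) \<Rightarrow> bool" where
  "W1inf_loc u v \<longleftrightarrow> Linf_loc v \<and> (\<forall>a b. a \<le> b \<longrightarrow> (v has_integral (u b - u a)) {a..b})"

text \<open>
  In \<open>W2inf_loc y y' y''\<close> the function \<open>y'\<close> is continuous, so it is the classical derivative of
  \<open>y\<close> at every point and its point values are meaningful; \<open>y''\<close> is determined only a.e.
\<close>

definition W2inf_loc :: "(real \<Rightarrow> complex) \<Rightarrow> (real \<Rightarrow> complex) \<Rightarrow> (real \<Rightarrow> complex) \<Rightarrow> bool" where
  "W2inf_loc y y' y'' \<longleftrightarrow> W1inf_loc y y' \<and> W1inf_loc y' y''"

definition const_outside :: "real \<Rightarrow> (real \<Rightarrow> real) \<Rightarrow> real \<Rightarrow> real \<Rightarrow> bool" where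
  "const_outside ninf \<epsilon> a b \<longleftrightarrow> a \<le> b \<and> (AE s in lebesgue. s \<notin> {a..b} \<longrightarrow> \<epsilon> s = ninf\<^sup>2)"

definition F_sym :: "real \<Rightarrow> real \<Rightarrow> real \<Rightarrow> (real \<Rightarrow> real) set" where
  "F_sym n1 n2 ninf = {\<epsilon>. Linf \<epsilon> \<and> (AE s in lebesgue. 0 < \<epsilon> s) \<and>
     (AE s in lebesgue. \<epsilon> s = \<epsilon> (- s)) \<and>
     (\<exists>a b. const_outside ninf \<epsilon> a b \<and>
        (AE s in lebesgue. s \<in> {a<..<b} \<longrightarrow> n1\<^sup>2 \<le> \<epsilon> s \<and> \<epsilon> s \<le> n2\<^sup>2))}"

definition shortest_interval :: "real \<Rightarrow> (real \<Rightarrow> real) \<Rightarrow> real \<times> real" where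
  "shortest_interval ninf \<epsilon> = (THE (s, t). const_outside ninf \<epsilon> s t \<and>
     (\<forall>a b. const_outside ninf \<epsilon> a b \<longrightarrow> t - s \<le> b - a))"

definition res_length :: "real \<Rightarrow> (real \<Rightarrow> real) \<Rightarrow> real" where
  "res_length ninf \<epsilon> =
     (if AE s in lebesgue. \<epsilon> s = ninf\<^sup>2 then 0
      else snd (shortest_interval ninf \<epsilon>) - fst (shortest_interval ninf \<epsilon>))"

text \<open>
  The outgoing conditions at \<open>a\<close> and \<open>b\<close> do not depend on the choice of the interval \<open>[a, b]\<close>
  outside of which \<open>\<epsilon>\<close> is constant, since outside of it the equation has constant coefficients.
\<close>

definition Sigma_odd :: "real \<Rightarrow> (real \<Rightarrow> real) \<Rightarrow> complex set" where
  "Sigma_odd ninf \<epsilon> = {\<kappa>. \<kappa> \<noteq> 0 \<and>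
     (\<exists>y y' y'' a b. W2inf_loc y y' y'' \<and> (\<exists>s. y s \<noteq> 0) \<and> (\<forall>s. y (- s) = - y s) \<and>
        (AE s in lebesgue. y'' s = - \<kappa>\<^sup>2 * of_real (\<epsilon> s) * y s) \<and>
        const_outside ninf \<epsilon> a b \<and>
        y' a / \<kappa> = - \<i> * of_real ninf * y a \<and>
        y' b / \<kappa> = \<i> * of_real ninf * y b)}"

definition admissible_odd :: "real \<Rightarrow> real \<Rightarrow> real \<Rightarrow> complex \<Rightarrow> (real \<Rightarrow> real) set" where
  "admissible_odd n1 n2 ninf \<kappa> = {\<epsilon> \<in> F_sym n1 n2 ninf. \<kappa> \<in> Sigma_odd ninf \<epsilon>}"

text \<open>Taken in the extended reals, so that the infimum over an empty family is \<open>\<infinity>\<close>.\<close>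

definition L_min_odd :: "real \<Rightarrow> real \<Rightarrow> real \<Rightarrow> complex \<Rightarrow> ereal" where
  "L_min_odd n1 n2 ninf \<kappa> = (INF \<epsilon> \<in> admissible_odd n1 n2 ninf \<kappa>. ereal (res_length ninf \<epsilon>))"

end

theory Submission
  imports Defs
begin

text \<open>
  Write \<open>\<kappa> = |\<kappa>| exp (- \<i> \<phi>)\<close> for the resonance \<open>\<kappa>\<^sub>0\<close>. It lies in the open fourth quadrant, so
  \<open>0 < \<phi> < \<pi> / 2\<close>. Let \<open>Y s = sin (\<kappa> n\<^sub>2 s) / (\<kappa> n\<^sub>2)\<close> be the odd solution with slope \<open>1\<close> at the
  origin for the constant coefficient \<open>n\<^sub>2\<^sup>2\<close>. Since
  \<open>\<kappa> n\<^sub>2 s\<^sub>+ = \<pi> / 2 - \<i> artanh (n\<^sub>\<infinity> / n\<^sub>2)\<close>, this \<open>Y\<close> satisfies the outgoing condition at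
  \<open>s\<^sub>+\<close>, and the single layer is admissible.

  Now let \<open>\<epsilon>\<close> be admissible with \<open>L \<epsilon> \<le> 2 s\<^sub>+\<close>, and let \<open>y\<close> be its odd solution, scaled to slope
  \<open>1\<close> at the origin. The shortest interval of \<open>\<epsilon>\<close> is symmetric
  (\<open>shortest_interval_symmetric\<close>), hence contained in \<open>[s\<^sub>-, s\<^sub>+]\<close>, and the outgoing condition for
  \<open>y\<close> can be moved to \<open>s\<^sub>+\<close> (\<open>outgoing_condition_transfer\<close>). There \<open>y\<close> and \<open>Y\<close> have the same
  logarithmic derivative. Hence the Wronskian of \<open>y\<close> and \<open>Y\<close> vanishes at both ends of \<open>[0, s\<^sub>+]\<close>,
  that is, the integral of \<open>(n\<^sub>2\<^sup>2 - \<epsilon>) y Y\<close> over this interval is \<open>0\<close>. The factor \<open>n\<^sub>2\<^sup>2 - \<epsilon>\<close> is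
  nonnegative, so it vanishes almost everywhere as soon as \<open>y Y\<close> stays in an open half plane
  (\<open>matching_solutions_imp_coefficient_eq\<close>). Then \<open>\<epsilon> = n\<^sub>2\<^sup>2\<close> on \<open>[0, s\<^sub>+]\<close> and, by symmetry, on
  \<open>[s\<^sub>-, s\<^sub>+]\<close>: an admissible profile that is not longer than the single layer coincides with it, which
  is minimality and uniqueness at once.

  On \<open>(0, s\<^sub>+)\<close> the argument of \<open>Y\<close> lies in \<open>(0, \<phi>)\<close>; this is computed from the formula for \<open>Y\<close>.
  The heart of the matter is that the same holds for \<open>y\<close> (\<open>solves_stays_in_sector\<close>), because then
  the argument of \<open>y Y\<close> lies in \<open>(0, 2 \<phi>)\<close>, which is contained in \<open>(0, \<pi>)\<close>. Among all
  coefficients below \<open>n\<^sub>2\<^sup>2\<close> the constant \<open>n\<^sub>2\<^sup>2\<close> turns the solution furthest. To see this, fix \<open>s\<close>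
  and follow \<open>\<epsilon>\<close> up to the point \<open>t\<close> and the constant \<open>n\<^sub>2\<^sup>2\<close> from \<open>t\<close> to \<open>s\<close>. The value reached
  at \<open>s\<close> is \<open>P t = y t * Y' (s - t) + y' t * Y (s - t)\<close>, which moves from \<open>Y s\<close> to \<open>y s\<close> as \<open>t\<close> runs
  through \<open>[0, s]\<close>, with velocity \<open>\<kappa>\<^sup>2 (n\<^sub>2\<^sup>2 - \<epsilon> t) y t * Y (s - t)\<close>. Two quadratic quantities
  that are monotone along solutions confine the arguments of \<open>y' / y\<close> and \<open>Y' / Y\<close> to
  \<open>[0, \<pi> - 2 \<phi>]\<close> (\<open>solves_log_derivative\<close>), and this is what makes \<open>P\<close> turn clockwise. So the
  argument of \<open>y s\<close> is at most that of \<open>Y s\<close>, provided that no full turns are lost on the way: as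
  long as \<open>y\<close> has stayed in the sector before \<open>s\<close>, the curve \<open>P\<close> runs in the upper half plane.
  A continuation argument in \<open>s\<close> removes the proviso.
\<close>

section \<open>Locally Lipschitz functions and their weak derivatives\<close>

lemma Linf_loc_bound:
  fixes f :: "real \<Rightarrow> complex"
  assumes "Linf_loc f"
  obtains C where "0 \<le> C" "AE s in lebesgue. s \<in> {a..b} \<longrightarrow> norm (f s) \<le> C"
proof -
  obtain C where C: "AE s in lebesgue. s \<in> {a..b} \<longrightarrow> norm (f s) \<le> C"
    using assms unfolding Linf_loc_def by blast
  have "AE s in lebesgue. s \<in> {a..b} \<longrightarrow> norm (f s) \<le> max C 0"
    using C by (rule AE_mp) (auto intro!: AE_I2)
  then show ?thesis by (rule that[rotated]) simp
qed

text \<open>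
  Integrals appear both as gauge integrals, in the definition of \<open>W1inf_loc\<close>, and as Bochner
  integrals, for the vanishing of a nonnegative function with integral \<open>0\<close>.
\<close>

lemma Linf_loc_integrable:
  fixes f :: "real \<Rightarrow> complex"
  assumes "Linf_loc f"
  shows "integrable (lebesgue_on {a..b}) f" and "f integrable_on {a..b}"
proof -
  obtain C where C: "AE s in lebesgue. s \<in> {a..b} \<longrightarrow> norm (f s) \<le> C"
    using assms unfolding Linf_loc_def by blast
  interpret finite_measure "lebesgue_on {a..b}"
    by (rule finite_measure_lebesgue_on) auto
  show "integrable (lebesgue_on {a..b}) f"
  proof (rule integrable_const_bound)
    show "AE s in lebesgue_on {a..b}. norm (f s) \<le> C"
      using C by (subst AE_restrict_space_iff) auto
    show "f \<in> borel_measurable (lebesgue_on {a..b})"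
      using assms unfolding Linf_loc_def by (auto intro: measurable_restrict_space1)
  qed
  then show "f integrable_on {a..b}"
    by (rule integrable_on_lebesgue_on) auto
qed

lemma Linf_loc_mult:
  fixes f g :: "real \<Rightarrow> complex"
  assumes "Linf_loc f" "Linf_loc g"
  shows "Linf_loc (\<lambda>s. f s * g s)"
  unfolding Linf_loc_def
proof (intro conjI allI)
  show "(\<lambda>s. f s * g s) \<in> borel_measurable lebesgue"
    using assms unfolding Linf_loc_def by (intro borel_measurable_times) auto
  fix a b
  obtain C where C: "0 \<le> C" "AE s in lebesgue. s \<in> {a..b} \<longrightarrow> norm (f s) \<le> C"
    using Linf_loc_bound[OF assms(1)] .
  obtain D where D: "0 \<le> D" "AE s in lebesgue. s \<in> {a..b} \<longrightarrow> norm (g s) \<le> D"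
    using Linf_loc_bound[OF assms(2)] .
  have "AE s in lebesgue. s \<in> {a..b} \<longrightarrow> norm (f s * g s) \<le> C * D"
    using C(2) D(2) by eventually_elim (auto simp: norm_mult intro!: mult_mono C(1))
  then show "\<exists>C. AE s in lebesgue. s \<in> {a..b} \<longrightarrow> norm (f s * g s) \<le> C" ..
qed

lemma Linf_loc_add:
  fixes f g :: "real \<Rightarrow> complex"
  assumes "Linf_loc f" "Linf_loc g"
  shows "Linf_loc (\<lambda>s. f s + g s)"
  unfolding Linf_loc_def
proof (intro conjI allI)
  show "(\<lambda>s. f s + g s) \<in> borel_measurable lebesgue"
    using assms unfolding Linf_loc_def by (intro borel_measurable_add) auto
  fix a b
  obtain C where C: "0 \<le> C" "AE s in lebesgue. s \<in> {a..b} \<longrightarrow> norm (f s) \<le> C"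
    using Linf_loc_bound[OF assms(1)] .
  obtain D where D: "0 \<le> D" "AE s in lebesgue. s \<in> {a..b} \<longrightarrow> norm (g s) \<le> D"
    using Linf_loc_bound[OF assms(2)] .
  have "AE s in lebesgue. s \<in> {a..b} \<longrightarrow> norm (f s + g s) \<le> C + D"
    using C(2) D(2) by eventually_elim (auto intro: norm_triangle_mono)
  then show "\<exists>C. AE s in lebesgue. s \<in> {a..b} \<longrightarrow> norm (f s + g s) \<le> C" ..
qed

lemma Linf_loc_continuous:
  fixes f :: "real \<Rightarrow> complex"
  assumes "continuous_on UNIV f"
  shows "Linf_loc f"
  unfolding Linf_loc_def
proof (intro conjI allI)
  have "f \<in> borel_measurable lborel"
    using borel_measurable_continuous_onI[OF assms] by simp
  then show "f \<in> borel_measurable lebesgue"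
    by (rule measurable_completion)
  fix a b
  have "bounded (f ` {a..b})"
    using assms by (intro compact_imp_bounded compact_continuous_image)
      (auto intro: continuous_on_subset)
  then obtain C where "\<And>s. s \<in> {a..b} \<Longrightarrow> norm (f s) \<le> C"
    unfolding bounded_iff by blast
  then show "\<exists>C. AE s in lebesgue. s \<in> {a..b} \<longrightarrow> norm (f s) \<le> C"
    by (intro exI[of _ C] AE_I2) blast
qed

text \<open>
  Cutting \<open>[a, b]\<close> into \<open>N\<close> equal pieces bounds the total increment by \<open>K (b - a)\<^sup>2 / N\<close>, and \<open>N\<close> is
  arbitrary. With the next lemma this replaces differentiation almost everywhere: weak derivatives
  are compared with increments directly.
\<close>

lemma quadratic_increments_imp_nonincreasing:
  fixes f :: "real \<Rightarrow> real"
  assumes ab: "a \<le> b" and K: "\<And>s t. \<lbrakk>a \<le> s; s \<le> t; t \<le> b\<rbrakk> \<Longrightarrow> f t - f s \<le> K * (t - s)\<^sup>2"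
  shows "f b \<le> f a"
proof -
  have step: "f b - f a \<le> K * (b - a)\<^sup>2 / real (Suc N)" for N
  proof -
    define h where "h = (b - a) / real (Suc N)"
    have h: "0 \<le> h" "real (Suc N) * h = b - a"
      using ab by (auto simp: h_def)
    have "f b - f a = (\<Sum>i<Suc N. f (a + real (Suc i) * h) - f (a + real i * h))"
      using h by (subst sum_lessThan_telescope[where f = "\<lambda>i. f (a + real i * h)"]) simp
    also have "\<dots> \<le> (\<Sum>i<Suc N. K * h\<^sup>2)"
    proof (rule sum_mono)
      fix i assume "i \<in> {..<Suc N}"
      then have "real (Suc i) * h \<le> real (Suc N) * h"
        using h(1) by (intro mult_right_mono) auto
      then have "f (a + real (Suc i) * h) - f (a + real i * h)
          \<le> K * ((a + real (Suc i) * h) - (a + real i * h))\<^sup>2"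
        using h by (intro K) (auto simp: algebra_simps)
      then show "f (a + real (Suc i) * h) - f (a + real i * h) \<le> K * h\<^sup>2"
        by (simp add: algebra_simps)
    qed
    also have "\<dots> = K * (real (Suc N) * h) * h"
      by (simp add: power2_eq_square)
    also have "\<dots> = K * (b - a)\<^sup>2 / real (Suc N)"
      unfolding h(2) by (simp add: h_def power2_eq_square)
    finally show ?thesis .
  qed
  have "(\<lambda>N. K * (b - a)\<^sup>2 / real (Suc N)) \<longlonglongrightarrow> 0"
    by (rule LIMSEQ_Suc[OF lim_const_over_n])
  then have "f b - f a \<le> 0"
    using step by (intro LIMSEQ_le_const) auto
  then show ?thesis by simp
qed

lemma quadratic_increments_imp_constant:
  fixes f :: "real \<Rightarrow> complex"
  assumes ab: "a \<le> b"
    and K: "\<And>s t. \<lbrakk>a \<le> s; s \<le> t; t \<le> b\<rbrakk> \<Longrightarrow> norm (f t - f s) \<le> K * (t - s)\<^sup>2"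
  shows "f b = f a"
proof -
  define d where "d = f b - f a"
  have "d \<bullet> f b \<le> d \<bullet> f a"
  proof (rule quadratic_increments_imp_nonincreasing[OF ab, where K = "norm d * K"])
    fix s t assume st: "a \<le> s" "s \<le> t" "t \<le> b"
    have "d \<bullet> f t - d \<bullet> f s = d \<bullet> (f t - f s)"
      by (simp add: inner_diff_right)
    also have "\<dots> \<le> norm d * norm (f t - f s)"
      by (rule norm_cauchy_schwarz)
    also have "\<dots> \<le> norm d * (K * (t - s)\<^sup>2)"
      by (intro mult_left_mono K st) auto
    finally show "d \<bullet> f t - d \<bullet> f s \<le> norm d * K * (t - s)\<^sup>2"
      by (simp add: mult.assoc)
  qed
  then have "d \<bullet> d \<le> 0"
    using inner_diff_right[of d "f b" "f a"] by (simp add: d_def)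
  then have "d = 0"
    using inner_ge_zero[of d] inner_eq_zero_iff[of d] by linarith
  then show ?thesis
    by (simp add: d_def)
qed

lemma integral_bound_AE:
  fixes f :: "real \<Rightarrow> complex"
  assumes "a \<le> b" "(f has_integral i) {a..b}" "0 \<le> C"
    "AE s in lebesgue. s \<in> {a..b} \<longrightarrow> norm (f s) \<le> C"
  shows "norm i \<le> C * (b - a)"
proof -
  obtain N where N: "negligible N" "{s. \<not> (s \<in> {a..b} \<longrightarrow> norm (f s) \<le> C)} \<subseteq> N"
    using assms(4) unfolding eventually_ae_filter_negligible by blast
  have "((\<lambda>s. if s \<in> N then 0 else f s) has_integral i) {a..b}"
    by (rule has_integral_spike[OF N(1) _ assms(2)]) auto
  then have "norm i \<le> C * Henstock_Kurzweil_Integration.content {a..b}"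
    by (rule has_integral_bound_real[OF assms(3) finite.emptyI]) (use N(2) assms(3) in auto)
  then show ?thesis using assms(1) by simp
qed

lemma integral_mono_AE:
  fixes f g :: "real \<Rightarrow> real"
  assumes "(f has_integral i) {a..b}" "(g has_integral j) {a..b}"
    "AE s in lebesgue. s \<in> {a..b} \<longrightarrow> f s \<le> g s"
  shows "i \<le> j"
proof -
  obtain N where N: "negligible N" "{s. \<not> (s \<in> {a..b} \<longrightarrow> f s \<le> g s)} \<subseteq> N"
    using assms(3) unfolding eventually_ae_filter_negligible by blast
  have f: "((\<lambda>s. if s \<in> N then 0 else f s) has_integral i) {a..b}"
    by (rule has_integral_spike[OF N(1) _ assms(1)]) auto
  have g: "((\<lambda>s. if s \<in> N then 0 else g s) has_integral j) {a..b}"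
    by (rule has_integral_spike[OF N(1) _ assms(2)]) auto
  show ?thesis
    by (rule has_integral_le[OF f g]) (use N(2) in auto)
qed

lemma W1inf_loc_Linf_loc: "W1inf_loc u v \<Longrightarrow> Linf_loc v"
  by (simp add: W1inf_loc_def)

lemma W1inf_loc_integral: "W1inf_loc u v \<Longrightarrow> a \<le> b \<Longrightarrow> (v has_integral (u b - u a)) {a..b}"
  by (simp add: W1inf_loc_def)

lemma W1inf_loc_lipschitz:
  assumes "W1inf_loc u v"
  shows "\<exists>C. 0 \<le> C \<and> (\<forall>s t. a \<le> s \<and> s \<le> t \<and> t \<le> b \<longrightarrow> norm (u t - u s) \<le> C * (t - s))
    \<and> (AE s in lebesgue. s \<in> {a..b} \<longrightarrow> norm (v s) \<le> C)"
proof -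
  obtain C where C: "0 \<le> C" "AE s in lebesgue. s \<in> {a..b} \<longrightarrow> norm (v s) \<le> C"
    using Linf_loc_bound[OF W1inf_loc_Linf_loc[OF assms]] .
  show ?thesis
  proof (intro exI[of _ C] conjI allI impI C)
    fix s t assume "a \<le> s \<and> s \<le> t \<and> t \<le> b"
    then have st: "a \<le> s" "s \<le> t" "t \<le> b"
      by auto
    have "AE r in lebesgue. r \<in> {s..t} \<longrightarrow> norm (v r) \<le> C"
      using C(2) by eventually_elim (use st in auto)
    then show "norm (u t - u s) \<le> C * (t - s)"
      by (intro integral_bound_AE[OF st(2) W1inf_loc_integral[OF assms st(2)] C(1)])
  qed
qed

lemma W1inf_loc_continuous:
  assumes "W1inf_loc u v"
  shows "continuous_on S u"
proof -
  have "isCont u x" for x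
  proof -
    obtain C where C: "0 \<le> C" "\<And>s t. \<lbrakk>x - 1 \<le> s; s \<le> t; t \<le> x + 1\<rbrakk> \<Longrightarrow> norm (u t - u s) \<le> C * (t - s)"
      "AE s in lebesgue. s \<in> {x - 1..x + 1} \<longrightarrow> norm (v s) \<le> C"
      using W1inf_loc_lipschitz[OF assms, of "x - 1" "x + 1"] by metis
    have "C-lipschitz_on {x - 1..x + 1} u"
    proof (rule lipschitz_onI[OF _ C(1)])
      fix s t assume st: "s \<in> {x - 1..x + 1}" "t \<in> {x - 1..x + 1}"
      show "dist (u s) (u t) \<le> C * dist s t"
      proof (cases "s \<le> t")
        case True
        with C(2)[of s t] st show ?thesis
          by (simp add: dist_norm[of "u s"] norm_minus_commute[of "u s"] dist_real_def)
      next
        case False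
        with C(2)[of t s] st show ?thesis
          by (simp add: dist_norm[of "u s"] dist_real_def)
      qed
    qed
    then have "continuous_on {x - 1..x + 1} u"
      by (rule lipschitz_on_continuous_on)
    then show ?thesis
      by (rule continuous_on_interior) simp
  qed
  then show ?thesis
    by (simp add: continuous_at_imp_continuous_on)
qed

text \<open>
  The defect between \<open>u1 u2\<close> and the indefinite integral of the expected derivative has increments
  of second order, because both factors are Lipschitz on bounded intervals. So it is constant.
\<close>

lemma W1inf_loc_mult:
  assumes 1: "W1inf_loc u1 v1" and 2: "W1inf_loc u2 v2"
  shows "W1inf_loc (\<lambda>s. u1 s * u2 s) (\<lambda>s. v1 s * u2 s + u1 s * v2 s)"
proof -
  define h where "h = (\<lambda>s. v1 s * u2 s + u1 s * v2 s)"
  have L: "Linf_loc h"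
    unfolding h_def
    using Linf_loc_continuous[OF W1inf_loc_continuous[OF 1]] W1inf_loc_Linf_loc[OF 1]
      Linf_loc_continuous[OF W1inf_loc_continuous[OF 2]] W1inf_loc_Linf_loc[OF 2]
    by (simp add: Linf_loc_add Linf_loc_mult)
  have "(h has_integral (u1 b * u2 b - u1 a * u2 a)) {a..b}" if ab: "a \<le> b" for a b
  proof -
    obtain C where C: "0 \<le> C" "\<And>s t. \<lbrakk>a \<le> s; s \<le> t; t \<le> b\<rbrakk> \<Longrightarrow> norm (u1 t - u1 s) \<le> C * (t - s)"
      "AE s in lebesgue. s \<in> {a..b} \<longrightarrow> norm (v1 s) \<le> C"
      using W1inf_loc_lipschitz[OF 1, of a b] by metis
    obtain D where D: "0 \<le> D" "\<And>s t. \<lbrakk>a \<le> s; s \<le> t; t \<le> b\<rbrakk> \<Longrightarrow> norm (u2 t - u2 s) \<le> D * (t - s)"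
      "AE s in lebesgue. s \<in> {a..b} \<longrightarrow> norm (v2 s) \<le> D"
      using W1inf_loc_lipschitz[OF 2, of a b] by metis
    define G where "G = (\<lambda>s. u1 s * u2 s - integral {a..s} h)"
    have int: "h integrable_on {s..t}" for s t
      by (rule Linf_loc_integrable(2)[OF L])
    have "G b = G a"
    proof (rule quadratic_increments_imp_constant[OF ab, where K = "2 * C * D"])
      fix s t assume st: "a \<le> s" "s \<le> t" "t \<le> b"
      have Gd: "G t - G s = (u1 t * u2 t - u1 s * u2 s) - integral {s..t} h"
        using Henstock_Kurzweil_Integration.integral_combine[OF st(1,2) int]
        by (auto simp: G_def algebra_simps)
      have "((\<lambda>r. v1 r * u2 t + u1 s * v2 r) has_integral
          ((u1 t - u1 s) * u2 t + u1 s * (u2 t - u2 s))) {s..t}"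
        by (rule has_integral_add[OF
            has_integral_mult_left[OF W1inf_loc_integral[OF 1 st(2)]]
            has_integral_mult_right[OF W1inf_loc_integral[OF 2 st(2)]]])
      note diff = has_integral_diff[OF this integrable_integral[OF int]]
      have eq1: "(u1 t - u1 s) * u2 t + u1 s * (u2 t - u2 s) - integral {s..t} h = G t - G s"
        unfolding Gd by (simp only: ring_distribs) simp
      have eq2: "(\<lambda>r. v1 r * u2 t + u1 s * v2 r - h r)
          = (\<lambda>r. v1 r * (u2 t - u2 r) + (u1 s - u1 r) * v2 r)"
      proof
        fix r
        show "v1 r * u2 t + u1 s * v2 r - h r = v1 r * (u2 t - u2 r) + (u1 s - u1 r) * v2 r"
          by (simp add: h_def algebra_simps)
      qed
      have I: "((\<lambda>r. v1 r * (u2 t - u2 r) + (u1 s - u1 r) * v2 r) has_integral (G t - G s)) {s..t}"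
        using diff unfolding eq1 eq2 .
      have "AE r in lebesgue. r \<in> {s..t} \<longrightarrow>
          norm (v1 r * (u2 t - u2 r) + (u1 s - u1 r) * v2 r) \<le> 2 * C * D * (t - s)"
        using C(3) D(3)
      proof eventually_elim
        case (elim r)
        show ?case
        proof
          assume r: "r \<in> {s..t}"
          then have sr: "a \<le> s" "s \<le> r" "r \<le> b" and rt: "a \<le> r" "r \<le> t" "t \<le> b"
            using st by auto
          have "norm (u2 t - u2 r) \<le> D * (t - s)"
            using D(2)[OF rt] mult_left_mono[of "t - r" "t - s" D] D(1) sr by linarith
          moreover have "norm (v1 r) \<le> C"
            using elim sr by auto
          ultimately have "norm (v1 r * (u2 t - u2 r)) \<le> C * (D * (t - s))"
            unfolding norm_mult by (intro mult_mono C(1) norm_ge_zero)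
          moreover have "norm (u1 s - u1 r) \<le> C * (t - s)"
            using C(2)[OF sr] mult_left_mono[of "r - s" "t - s" C] C(1) rt norm_minus_commute[of "u1 s" "u1 r"]
            by linarith
          then have "norm ((u1 s - u1 r) * v2 r) \<le> (C * (t - s)) * D"
            unfolding norm_mult using elim sr C(1) st(2) by (intro mult_mono) auto
          ultimately show "norm (v1 r * (u2 t - u2 r) + (u1 s - u1 r) * v2 r) \<le> 2 * C * D * (t - s)"
            using norm_triangle_ineq[of "v1 r * (u2 t - u2 r)" "(u1 s - u1 r) * v2 r"]
            by (simp add: algebra_simps)
        qed
      qed
      then have "norm (G t - G s) \<le> 2 * C * D * (t - s) * (t - s)"
        by (rule integral_bound_AE[OF st(2) I, rotated]) (use C(1) D(1) st in simp)
      then show "norm (G t - G s) \<le> 2 * C * D * (t - s)\<^sup>2"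
        by (simp add: power2_eq_square mult.assoc)
    qed
    moreover have "G a = u1 a * u2 a"
      by (simp add: G_def)
    ultimately have "integral {a..b} h = u1 b * u2 b - u1 a * u2 a"
      unfolding G_def by (simp only: diff_eq_eq eq_diff_eq add.commute)
    with integrable_integral[OF int, of a b] show ?thesis
      by (simp only:)
  qed
  then show ?thesis
    using L unfolding W1inf_loc_def h_def[symmetric] by blast
qed

lemma W1inf_loc_C1:
  assumes "\<And>s. (u has_vector_derivative v s) (at s)" "continuous_on UNIV v"
  shows "W1inf_loc u v"
  unfolding W1inf_loc_def
  using Linf_loc_continuous[OF assms(2)]
    fundamental_theorem_of_calculus[OF _ has_vector_derivative_at_within[OF assms(1)]]
  by blast

lemma W1inf_loc_const: "W1inf_loc (\<lambda>s. c) (\<lambda>s. 0)"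
  by (rule W1inf_loc_C1) auto

lemma W1inf_loc_add:
  assumes "W1inf_loc u1 v1" "W1inf_loc u2 v2"
  shows "W1inf_loc (\<lambda>s. u1 s + u2 s) (\<lambda>s. v1 s + v2 s)"
proof -
  have "((\<lambda>s. v1 s + v2 s) has_integral ((u1 b + u2 b) - (u1 a + u2 a))) {a..b}" if "a \<le> b" for a b
    unfolding add_diff_add
    by (rule has_integral_add[OF W1inf_loc_integral[OF assms(1) that] W1inf_loc_integral[OF assms(2) that]])
  then show ?thesis
    using assms Linf_loc_add unfolding W1inf_loc_def by blast
qed

lemma W1inf_loc_cmult:
  assumes "W1inf_loc u v"
  shows "W1inf_loc (\<lambda>s. c * u s) (\<lambda>s. c * v s)"
  using W1inf_loc_mult[OF W1inf_loc_const[of c] assms] by simp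

lemma W1inf_loc_diff:
  assumes "W1inf_loc u1 v1" "W1inf_loc u2 v2"
  shows "W1inf_loc (\<lambda>s. u1 s - u2 s) (\<lambda>s. v1 s - v2 s)"
  using W1inf_loc_add[OF assms(1) W1inf_loc_cmult[OF assms(2), of "-1"]] by simp

lemma W1inf_loc_cnj:
  assumes "W1inf_loc u v"
  shows "W1inf_loc (\<lambda>s. cnj (u s)) (\<lambda>s. cnj (v s))"
proof -
  have "(\<lambda>s. cnj (v s)) \<in> borel_measurable lebesgue"
    using assms unfolding W1inf_loc_def Linf_loc_def
    by (intro measurable_compose[of v lebesgue borel cnj borel]) (auto intro!: borel_measurable_continuous_onI continuous_intros)
  moreover have "((\<lambda>s. cnj (v s)) has_integral (cnj (u b) - cnj (u a))) {a..b}" if "a \<le> b" for a b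
    using has_integral_linear[OF W1inf_loc_integral[OF assms that] bounded_linear_cnj]
    by (simp add: o_def)
  ultimately show ?thesis
    using assms unfolding W1inf_loc_def Linf_loc_def by simp
qed

lemma W1inf_loc_DERIV:
  assumes "W1inf_loc u v" "continuous_on UNIV v"
  shows "(u has_vector_derivative v x) (at x)"
proof -
  have "((\<lambda>t. integral {x - 1..t} v) has_vector_derivative v x) (at x within {x - 1..x + 1})"
    by (rule integral_has_vector_derivative) (auto intro: continuous_on_subset[OF assms(2)])
  then have "((\<lambda>t. integral {x - 1..t} v + u (x - 1)) has_vector_derivative v x) (at x within {x - 1..x + 1})"
    by (simp add: has_vector_derivative_add_const)
  then have "(u has_vector_derivative v x) (at x within {x - 1..x + 1})"
  proof (rule has_vector_derivative_transform[rotated 2])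
    fix t assume "t \<in> {x - 1..x + 1}"
    then show "u t = integral {x - 1..t} v + u (x - 1)"
      using integral_unique[OF W1inf_loc_integral[OF assms(1), of "x - 1" t]] by simp
  qed auto
  then have "(u has_vector_derivative v x) (at x within {x - 1<..<x + 1})"
    by (rule has_vector_derivative_within_subset) auto
  then show ?thesis
    by (subst (asm) at_within_open) auto
qed

lemma W1inf_loc_Im_nondecreasing:
  assumes "W1inf_loc u v" "a \<le> b" "AE s in lebesgue. s \<in> {a..b} \<longrightarrow> 0 \<le> Im (v s)"
  shows "Im (u a) \<le> Im (u b)"
proof -
  have "((\<lambda>s. Im (v s)) has_integral Im (u b - u a)) {a..b}"
    by (rule has_integral_Im[OF W1inf_loc_integral[OF assms(1,2)]])
  from integral_mono_AE[OF has_integral_0 this assms(3)] show ?thesis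
    by simp
qed

lemma W1inf_loc_zero_derivative:
  assumes "W1inf_loc u v" "a \<le> b" "AE s in lebesgue. s \<in> {a..b} \<longrightarrow> v s = 0"
  shows "u a = u b"
proof -
  have "AE s in lebesgue. s \<in> {a..b} \<longrightarrow> norm (v s) \<le> 0"
    using assms(3) by simp
  from integral_bound_AE[OF assms(2) W1inf_loc_integral[OF assms(1,2)] _ this] show ?thesis
    by simp
qed

lemma W1inf_loc_cong_AE:
  assumes "W1inf_loc u v" "AE s in lebesgue. v s = w s" "w \<in> borel_measurable lebesgue"
  shows "W1inf_loc u w"
proof -
  have "\<exists>C. AE s in lebesgue. s \<in> {a..b} \<longrightarrow> norm (w s) \<le> C" for a b
  proof -
    obtain C where "AE s in lebesgue. s \<in> {a..b} \<longrightarrow> norm (v s) \<le> C"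
      using assms(1) unfolding W1inf_loc_def Linf_loc_def by blast
    then have "AE s in lebesgue. s \<in> {a..b} \<longrightarrow> norm (w s) \<le> C"
      using assms(2) by eventually_elim simp
    then show ?thesis ..
  qed
  moreover have "(w has_integral (u b - u a)) {a..b}" if "a \<le> b" for a b
  proof -
    obtain N where N: "negligible N" "{s. v s \<noteq> w s} \<subseteq> N"
      using assms(2) unfolding eventually_ae_filter_negligible by blast
    show ?thesis
      by (rule has_integral_spike[OF N(1) _ W1inf_loc_integral[OF assms(1) that]]) (use N(2) in force)
  qed
  ultimately show ?thesis
    using assms(3) unfolding W1inf_loc_def Linf_loc_def by blast
qed

lemma W1inf_loc_reversed:
  assumes "\<And>t. (u has_vector_derivative v t) (at t)" "continuous_on UNIV v"
  shows "W1inf_loc (\<lambda>t. u (s - t)) (\<lambda>t. - v (s - t))"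
proof (rule W1inf_loc_C1)
  fix t
  have "((\<lambda>t. s - t) has_vector_derivative - 1) (at t)"
    by (auto intro!: derivative_eq_intros)
  from vector_diff_chain_at[OF this assms(1)]
  show "((\<lambda>t. u (s - t)) has_vector_derivative - v (s - t)) (at t)"
    by (simp add: o_def)
next
  show "continuous_on UNIV (\<lambda>t. - v (s - t))"
    by (intro continuous_intros continuous_on_compose2[OF assms(2)]) auto
qed

lemma W1inf_loc_piecewise:
  assumes "finite A" "continuous_on UNIV u" "\<And>s. s \<notin> A \<Longrightarrow> (u has_vector_derivative v s) (at s)" "Linf_loc v"
  shows "W1inf_loc u v"
  unfolding W1inf_loc_def
proof (intro conjI allI impI assms(4))
  fix a b :: real assume "a \<le> b"
  then show "(v has_integral (u b - u a)) {a..b}"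
    by (intro fundamental_theorem_of_calculus_interior_strong[OF assms(1)] assms(3)
        continuous_on_subset[OF assms(2)]) auto
qed

lemma AE_lebesgue_reflect:
  fixes P :: "real \<Rightarrow> bool"
  assumes "AE s in lebesgue. P s"
  shows "AE s in lebesgue. P (- s)"
proof -
  obtain N where N: "negligible N" "{s. \<not> P s} \<subseteq> N"
    using assms unfolding eventually_ae_filter_negligible by blast
  have "negligible (uminus ` N)"
    by (rule negligible_differentiable_image_negligible[OF _ N(1)])
      (auto intro!: derivative_intros)
  moreover have "{s. \<not> P (- s)} \<subseteq> uminus ` N"
  proof
    fix s assume "s \<in> {s. \<not> P (- s)}"
    then have "- s \<in> N" using N(2) by auto
    then show "s \<in> uminus ` N" by force
  qed
  ultimately show ?thesis
    unfolding eventually_ae_filter_negligible by blast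
qed

lemma AE_lebesgue_open_ex:
  fixes P :: "real \<Rightarrow> bool"
  assumes "AE s in lebesgue. P s" "c < d"
  obtains s where "c < s" "s < d" "P s"
proof -
  obtain N where N: "negligible N" "{s. \<not> P s} \<subseteq> N"
    using assms unfolding eventually_ae_filter_negligible by blast
  have "\<not> {c<..<d} \<subseteq> N"
    using negligible_subset[OF N(1), of "{c<..<d}"] open_not_negligible[of "{c<..<d}"] assms(2) by auto
  then show ?thesis
    using N(2) that by force
qed

lemma AE_neq: "AE s in lebesgue. s \<noteq> (c::real)"
  by (intro AE_completion AE_lborel_singleton)

section \<open>Plane curves and sectors\<close>

text \<open>
  The slope \<open>Im p / Re p\<close> is the tangent of the argument, and its derivative is
  \<open>Im (p' cnj p) / (Re p)\<^sup>2\<close>.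
\<close>

lemma rotating_curve_slope_increasing:
  assumes D: "\<And>s. (p has_vector_derivative q s) (at s)" and ab: "a < b"
    and pos: "\<And>s. s \<in> {a..b} \<Longrightarrow> 0 < Re (p s)"
    and rot: "\<And>s. s \<in> {a<..<b} \<Longrightarrow> 0 < Im (q s * cnj (p s))"
  shows "Im (p a) / Re (p a) < Im (p b) / Re (p b)"
proof -
  have Dre: "((\<lambda>s. Re (p s)) has_real_derivative Re (q s)) (at s)" for s
    using bounded_linear.has_vector_derivative[OF bounded_linear_Re D]
    by (simp add: has_real_derivative_iff_has_vector_derivative)
  have Dim: "((\<lambda>s. Im (p s)) has_real_derivative Im (q s)) (at s)" for s
    using bounded_linear.has_vector_derivative[OF bounded_linear_Im D]
    by (simp add: has_real_derivative_iff_has_vector_derivative)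
  have deriv: "((\<lambda>s. Im (p s) / Re (p s)) has_real_derivative
      (Im (q s) * Re (p s) - Im (p s) * Re (q s)) / (Re (p s) * Re (p s))) (at s)"
    if "s \<in> {a..b}" for s
    using DERIV_divide[OF Dim Dre, of s] pos[OF that] by simp
  show ?thesis
  proof (rule DERIV_pos_imp_increasing_open[OF ab])
    fix s assume s: "a < s" "s < b"
    have "0 < (Im (q s) * Re (p s) - Im (p s) * Re (q s)) / (Re (p s) * Re (p s))"
      using rot[of s] pos[of s] s by (intro divide_pos_pos mult_pos_pos) (auto simp: algebra_simps)
    then show "\<exists>y. ((\<lambda>s. Im (p s) / Re (p s)) has_real_derivative y) (at s) \<and> 0 < y"
      using deriv[of s] s by auto
  next
    show "continuous_on {a..b} (\<lambda>s. Im (p s) / Re (p s))"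
      using deriv DERIV_isCont by (intro continuous_at_imp_continuous_on) blast
  qed
qed

text \<open>
  A velocity \<open>q\<close> with \<open>Im (q cnj p) \<le> 0\<close> points clockwise, so the cotangent \<open>Re p / Im p\<close> of the
  argument of \<open>p\<close> does not decrease. As \<open>q\<close> is a derivative only in the weak sense, this is read off
  from the increments of the cotangent, whose negative parts are of second order in the length of
  the interval.
\<close>

lemma W1inf_loc_turns_clockwise:
  assumes W: "W1inf_loc p q" and ab: "a \<le> b"
    and up: "\<And>s. s \<in> {a..b} \<Longrightarrow> 0 < Im (p s)"
    and turn: "AE s in lebesgue. s \<in> {a..b} \<longrightarrow> Im (q s * cnj (p s)) \<le> 0"
  shows "Im (p b * cnj (p a)) \<le> 0"
proof -
  have "continuous_on {a..b} (\<lambda>s. Im (p s))"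
    by (intro continuous_intros W1inf_loc_continuous[OF W])
  then obtain c where c: "c \<in> {a..b}" "\<And>s. s \<in> {a..b} \<Longrightarrow> Im (p c) \<le> Im (p s)"
    using continuous_attains_inf[of "{a..b}" "\<lambda>s. Im (p s)"] ab by auto
  define m where "m = Im (p c)"
  have m: "0 < m" "\<And>s. s \<in> {a..b} \<Longrightarrow> m \<le> Im (p s)"
    using c up by (auto simp: m_def)
  obtain C where C: "0 \<le> C" "\<And>s t. \<lbrakk>a \<le> s; s \<le> t; t \<le> b\<rbrakk> \<Longrightarrow> norm (p t - p s) \<le> C * (t - s)"
    "AE s in lebesgue. s \<in> {a..b} \<longrightarrow> norm (q s) \<le> C"
    using W1inf_loc_lipschitz[OF W, of a b] by metis
  define f where "f = (\<lambda>s. - Re (p s) / Im (p s))"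
  have "f b \<le> f a"
  proof (rule quadratic_increments_imp_nonincreasing[OF ab, where K = "C\<^sup>2 / m\<^sup>2"])
    fix s t assume st: "a \<le> s" "s \<le> t" "t \<le> b"
    have I: "((\<lambda>r. Im (q r * cnj (p s))) has_integral Im ((p t - p s) * cnj (p s))) {s..t}"
      by (rule has_integral_Im, rule has_integral_mult_left, rule W1inf_loc_integral[OF W st(2)])
    have J: "((\<lambda>r. C * (C * (t - s))) has_integral (t - s) * (C * (C * (t - s)))) {s..t}"
      using has_integral_const_real[of "C * (C * (t - s))" s t] st(2) by simp
    have "AE r in lebesgue. r \<in> {s..t} \<longrightarrow> Im (q r * cnj (p s)) \<le> C * (C * (t - s))"
      using C(3) turn
    proof eventually_elim
      case (elim r)
      show ?case
      proof
        assume r: "r \<in> {s..t}"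
        have "Im (q r * cnj (p s)) = Im (q r * cnj (p r)) + Im (q r * cnj (p s - p r))"
          by (simp add: algebra_simps)
        also have "\<dots> \<le> 0 + norm (q r * cnj (p s - p r))"
          using elim r st abs_Im_le_cmod[of "q r * cnj (p s - p r)"] by auto
        also have "\<dots> = norm (q r) * norm (p r - p s)"
          unfolding norm_mult complex_mod_cnj by (simp only: norm_minus_commute[of "p s"])
        also have "\<dots> \<le> C * (C * (t - s))"
        proof (rule mult_mono)
          show "norm (p r - p s) \<le> C * (t - s)"
            using r st C(2)[of s r] mult_left_mono[of "r - s" "t - s" C] C(1) by auto
        qed (use elim r st C(1) in auto)
        finally show "Im (q r * cnj (p s)) \<le> C * (C * (t - s))" .
      qed
    qed
    from integral_mono_AE[OF I J this]
    have le: "Im ((p t - p s) * cnj (p s)) \<le> C\<^sup>2 * (t - s)\<^sup>2"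
      by (simp add: power2_eq_square algebra_simps)
    have pos: "0 < Im (p s)" "0 < Im (p t)"
      using up st by auto
    have "f t - f s = Im ((p t - p s) * cnj (p s)) / (Im (p s) * Im (p t))"
      using pos by (simp add: f_def field_simps)
    also have "\<dots> \<le> C\<^sup>2 * (t - s)\<^sup>2 / (Im (p s) * Im (p t))"
      using le pos by (intro divide_right_mono) auto
    also have "\<dots> \<le> C\<^sup>2 * (t - s)\<^sup>2 / (m * m)"
      using m(1) pos m(2)[of s] m(2)[of t] st by (intro divide_left_mono mult_mono) auto
    finally show "f t - f s \<le> C\<^sup>2 / m\<^sup>2 * (t - s)\<^sup>2"
      by (simp add: power2_eq_square)
  qed
  then show ?thesis
    using up[of a] up[of b] ab by (simp add: f_def field_simps)
qed

text \<open>
  For \<open>\<kappa> = |\<kappa>| exp (- \<i> \<phi>)\<close> in the fourth quadrant this is the sector of arguments strictly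
  between \<open>0\<close> and \<open>\<phi>\<close> (\<open>sector_polar\<close>); the two linear inequalities spare a case analysis on
  branches of the argument.
\<close>

definition sector :: "complex \<Rightarrow> complex set" where
  "sector \<kappa> = {z. 0 < Im z \<and> Im (\<kappa> * z) < 0}"

lemma upper_half_plane_polar:
  assumes "0 < Im z"
  obtains r \<theta> where "0 < r" "0 < \<theta>" "\<theta> < pi" "z = rcis r \<theta>"
proof -
  have "0 < Arg z" "Arg z < pi"
    using assms Arg_lt_pi by blast+
  moreover have "0 < norm z"
    using assms by auto
  ultimately show ?thesis
    using that[of "norm z" "Arg z"] rcis_cmod_Arg[of z] by simp
qed

lemma Im_rcis_pos_iff: "0 < r \<Longrightarrow> 0 < Im (rcis r \<theta>) \<longleftrightarrow> 0 < sin \<theta>"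
  by (simp add: zero_less_mult_iff)

lemma Im_rcis_neg_iff: "0 < r \<Longrightarrow> Im (rcis r \<theta>) < 0 \<longleftrightarrow> sin \<theta> < 0"
  by (simp add: mult_less_0_iff)

lemma Im_rcis_nonpos_iff: "0 < r \<Longrightarrow> Im (rcis r \<theta>) \<le> 0 \<longleftrightarrow> sin \<theta> \<le> 0"
  by (simp add: mult_le_0_iff)

lemma fourth_quadrant_polar:
  assumes "0 < Re \<kappa>" "Im \<kappa> < 0"
  obtains r \<phi> where "0 < r" "0 < \<phi>" "\<phi> < pi / 2" "\<kappa> = rcis r (- \<phi>)"
proof -
  have "0 < Im (cnj \<kappa>)" using assms by simp
  then obtain r \<phi> where rp: "0 < r" "0 < \<phi>" "\<phi> < pi" "cnj \<kappa> = rcis r \<phi>"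
    by (rule upper_half_plane_polar)
  have "\<kappa> = cnj (rcis r \<phi>)"
    using rp(4) by (metis complex_cnj_cnj)
  then have \<kappa>: "\<kappa> = rcis r (- \<phi>)"
    by (simp add: rcis_def cis_cnj)
  have "0 < cos \<phi>"
    using assms(1) rp(1) unfolding \<kappa> by (simp add: zero_less_mult_iff)
  have "\<phi> < pi / 2"
  proof (rule ccontr)
    assume "\<not> \<phi> < pi / 2"
    then have "cos \<phi> \<le> cos (pi / 2)"
      using rp by (intro cos_monotone_0_pi_le) auto
    with \<open>0 < cos \<phi>\<close> show False by simp
  qed
  with rp \<kappa> that show ?thesis by blast
qed

lemma sector_polar:
  assumes "z \<in> sector (rcis r (- \<phi>))" "0 < r" "0 < \<phi>" "\<phi> < pi / 2"
  obtains \<rho> \<theta> where "0 < \<rho>" "0 < \<theta>" "\<theta> < \<phi>" "z = rcis \<rho> \<theta>"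
proof -
  obtain \<rho> \<theta> where z: "0 < \<rho>" "0 < \<theta>" "\<theta> < pi" "z = rcis \<rho> \<theta>"
    using assms(1) upper_half_plane_polar unfolding sector_def by blast
  have "Im (rcis (r * \<rho>) (- \<phi> + \<theta>)) < 0"
    using assms(1) unfolding sector_def z(4) by (simp only: mem_Collect_eq rcis_mult)
  then have "sin (\<theta> - \<phi>) < 0"
    using assms(2) z(1) by (subst (asm) Im_rcis_neg_iff) (auto simp: algebra_simps)
  then have "\<theta> < \<phi>"
    using sin_ge_zero[of "\<theta> - \<phi>"] assms z by linarith
  with z that show ?thesis by blast
qed

text \<open>
  The arguments of \<open>a\<close> and \<open>b\<close> add up to less than \<open>2 \<phi> < \<pi>\<close>.
\<close>

lemma sector_product:
  assumes "0 < Re \<kappa>" "Im \<kappa> < 0" "a \<in> sector \<kappa>" "b \<in> sector \<kappa>"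
  shows "0 < Im (a * b)"
proof -
  obtain r \<phi> where k: "0 < r" "0 < \<phi>" "\<phi> < pi / 2" "\<kappa> = rcis r (- \<phi>)"
    using fourth_quadrant_polar[OF assms(1,2)] by blast
  obtain r1 \<alpha> where a: "0 < r1" "0 < \<alpha>" "\<alpha> < \<phi>" "a = rcis r1 \<alpha>"
    using sector_polar[OF assms(3)[unfolded k(4)] k(1-3)] by blast
  obtain r2 \<beta> where b: "0 < r2" "0 < \<beta>" "\<beta> < \<phi>" "b = rcis r2 \<beta>"
    using sector_polar[OF assms(4)[unfolded k(4)] k(1-3)] by blast
  show ?thesis
    unfolding a(4) b(4) rcis_mult using a b k
    by (subst Im_rcis_pos_iff) (auto intro!: sin_gt_zero)
qed

text \<open>
  The hypotheses on \<open>w\<close> say that its argument lies in \<open>(0, \<pi> - 2 \<phi>]\<close>. The three arguments add up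
  to less than \<open>\<phi> + \<phi> + (\<pi> - 2 \<phi>) = \<pi>\<close>.
\<close>

lemma sector_triple_product:
  assumes "0 < Re \<kappa>" "Im \<kappa> < 0" "a \<in> sector \<kappa>" "b \<in> sector \<kappa>"
    and w: "0 < Im w" "Im (\<kappa>\<^sup>2 * cnj w) \<le> 0"
  shows "0 < Im (a * b * w)"
proof -
  obtain r \<phi> where k: "0 < r" "0 < \<phi>" "\<phi> < pi / 2" "\<kappa> = rcis r (- \<phi>)"
    using fourth_quadrant_polar[OF assms(1,2)] by blast
  obtain r1 \<alpha> where a: "0 < r1" "0 < \<alpha>" "\<alpha> < \<phi>" "a = rcis r1 \<alpha>"
    using sector_polar[OF assms(3)[unfolded k(4)] k(1-3)] by blast
  obtain r2 \<beta> where b: "0 < r2" "0 < \<beta>" "\<beta> < \<phi>" "b = rcis r2 \<beta>"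
    using sector_polar[OF assms(4)[unfolded k(4)] k(1-3)] by blast
  obtain r3 \<gamma> where c: "0 < r3" "0 < \<gamma>" "\<gamma> < pi" "w = rcis r3 \<gamma>"
    using upper_half_plane_polar[OF w(1)] by blast
  have "\<kappa>\<^sup>2 * cnj w = rcis (r * r * r3) (- (2 * \<phi> + \<gamma>))"
    unfolding k(4) c(4) power2_eq_square
    by (simp add: rcis_def cis_cnj cis_mult)
  then have "0 \<le> sin (2 * \<phi> + \<gamma>)"
    using w(2) Im_rcis_nonpos_iff[of "r * r * r3" "- (2 * \<phi> + \<gamma>)"] k(1) c(1) sin_minus[of "2 * \<phi> + \<gamma>"]
    by simp
  moreover have "sin (2 * \<phi> + \<gamma>) < 0" if "pi < 2 * \<phi> + \<gamma>"
    using that k c by (intro sin_lt_zero) auto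
  ultimately have "2 * \<phi> + \<gamma> \<le> pi" by force
  then show ?thesis
    unfolding a(4) b(4) c(4) rcis_mult using a b c
    by (subst Im_rcis_pos_iff) (auto intro!: sin_gt_zero)
qed

text \<open>
  Both points have arguments in \<open>(0, \<pi>)\<close>, where the sign of \<open>Im (a cnj b)\<close> decides which argument is
  larger.
\<close>

lemma sector_clockwise:
  assumes "0 < Re \<kappa>" "Im \<kappa> < 0" "b \<in> sector \<kappa>" "0 < Im a" "Im (a * cnj b) \<le> 0"
  shows "a \<in> sector \<kappa>"
proof -
  obtain r \<phi> where k: "0 < r" "0 < \<phi>" "\<phi> < pi / 2" "\<kappa> = rcis r (- \<phi>)"
    using fourth_quadrant_polar[OF assms(1,2)] by blast
  obtain r1 \<alpha> where a: "0 < r1" "0 < \<alpha>" "\<alpha> < pi" "a = rcis r1 \<alpha>"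
    using upper_half_plane_polar[OF assms(4)] by blast
  obtain r2 \<beta> where b: "0 < r2" "0 < \<beta>" "\<beta> < \<phi>" "b = rcis r2 \<beta>"
    using sector_polar[OF assms(3)[unfolded k(4)] k(1-3)] by blast
  have "a * cnj b = rcis (r1 * r2) (\<alpha> - \<beta>)"
    unfolding a(4) b(4) by (simp add: rcis_def cis_cnj cis_mult)
  then have "sin (\<alpha> - \<beta>) \<le> 0"
    using assms(5) a(1) b(1) by (simp add: mult_le_0_iff)
  then have "\<alpha> \<le> \<beta>"
    using sin_gt_zero[of "\<alpha> - \<beta>"] a b by force
  then have "sin (\<alpha> - \<phi>) < 0"
    using sin_gt_zero[of "\<phi> - \<alpha>"] a b k sin_minus[of "\<phi> - \<alpha>"] by simp
  moreover have "\<kappa> * a = rcis (r * r1) (\<alpha> - \<phi>)"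
    unfolding a(4) k(4) rcis_mult by simp
  ultimately have "Im (\<kappa> * a) < 0"
    using Im_rcis_neg_iff[of "r * r1" "\<alpha> - \<phi>"] a(1) k(1) by (simp only: mult_pos_pos)
  then show ?thesis
    using assms(4) unfolding sector_def by blast
qed

lemma fourth_quadrant_square: "0 < Re \<kappa> \<Longrightarrow> Im \<kappa> < 0 \<Longrightarrow> Im (\<kappa>\<^sup>2) < 0"
  using mult_pos_neg[of "Re \<kappa>" "Im \<kappa>"] by (simp add: power2_eq_square mult.commute)

lemma sector_closure_Re_pos:
  assumes \<kappa>: "0 < Re \<kappa>" "Im \<kappa> < 0" and z: "0 \<le> Im z" "Im (\<kappa> * z) \<le> 0" "z \<noteq> 0"
  shows "0 < Re z"
proof (rule ccontr)
  assume "\<not> 0 < Re z"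
  then have 1: "0 \<le> Im \<kappa> * Re z"
    using \<kappa> by (intro mult_nonpos_nonpos) auto
  have 2: "0 \<le> Re \<kappa> * Im z"
    using \<kappa> z by (intro mult_nonneg_nonneg) auto
  have "Im \<kappa> * Re z + Re \<kappa> * Im z \<le> 0"
    using z(2) by simp
  then have "Im \<kappa> * Re z = 0" "Re \<kappa> * Im z = 0"
    using 1 2 by linarith+
  then have "z = 0"
    using \<kappa> by (simp add: complex_eq_iff)
  with z(3) show False ..
qed

lemma open_sector: "open (sector \<kappa>)"
  unfolding sector_def by (intro open_Collect_conj open_Collect_less continuous_intros)

section \<open>Logarithmic derivatives of solutions\<close>

text \<open>
  The equation \<open>y'' = - \<kappa>\<^sup>2 \<epsilon> y\<close> with its right-hand side chosen as the representative of \<open>y''\<close>, so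
  that products with \<open>y'\<close> have explicit weak derivatives.
\<close>

definition solves :: "complex \<Rightarrow> (real \<Rightarrow> real) \<Rightarrow> (real \<Rightarrow> complex) \<Rightarrow> (real \<Rightarrow> complex) \<Rightarrow> bool" where
  "solves \<kappa> \<epsilon> y y' \<longleftrightarrow> W1inf_loc y y' \<and> W1inf_loc y' (\<lambda>s. - \<kappa>\<^sup>2 * of_real (\<epsilon> s) * y s)"

lemma solvesD:
  assumes "solves \<kappa> \<epsilon> y y'"
  shows "W1inf_loc y y'" "W1inf_loc y' (\<lambda>s. - \<kappa>\<^sup>2 * of_real (\<epsilon> s) * y s)"
    "(y has_vector_derivative y' s) (at s)"
  using assms W1inf_loc_DERIV W1inf_loc_continuous unfolding solves_def by blast+

lemma solves_real_derivatives:
  assumes "solves \<kappa> \<epsilon> y y'"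
  shows "((\<lambda>s. Re (c * y s)) has_real_derivative Re (c * y' s)) (at s)"
    "((\<lambda>s. Im (c * y s)) has_real_derivative Im (c * y' s)) (at s)"
proof -
  have D: "((\<lambda>s. c * y s) has_vector_derivative c * y' s) (at s)"
    by (rule bounded_linear.has_vector_derivative[OF bounded_linear_mult_right solvesD(3)[OF assms]])
  show "((\<lambda>s. Re (c * y s)) has_real_derivative Re (c * y' s)) (at s)"
    using bounded_linear.has_vector_derivative[OF bounded_linear_Re D]
    by (simp add: has_real_derivative_iff_has_vector_derivative)
  show "((\<lambda>s. Im (c * y s)) has_real_derivative Im (c * y' s)) (at s)"
    using bounded_linear.has_vector_derivative[OF bounded_linear_Im D]
    by (simp add: has_real_derivative_iff_has_vector_derivative)
qed

lemma solves_scale: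
  assumes "solves \<kappa> \<epsilon> y y'"
  shows "solves \<kappa> \<epsilon> (\<lambda>s. c * y s) (\<lambda>s. c * y' s)"
  using W1inf_loc_cmult[OF solvesD(1)[OF assms], of c] W1inf_loc_cmult[OF solvesD(2)[OF assms], of c]
  unfolding solves_def by (simp add: mult.left_commute mult.assoc)

text \<open>
  The product \<open>y' cnj y\<close> has the argument of \<open>y' / y\<close>. Its derivative is a combination of
  \<open>|y'|\<^sup>2\<close> and \<open>\<epsilon> |y|\<^sup>2\<close> with the fixed coefficients \<open>1\<close> and \<open>- \<kappa>\<^sup>2\<close>; multiplying by a suitable
  constant and taking imaginary parts leaves only one of the two. This gives the two bounds on the
  argument of \<open>y' / y\<close> below.
\<close>

lemma solves_W1inf_loc_flux:
  assumes "solves \<kappa> \<epsilon> y y'"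
  shows "W1inf_loc (\<lambda>s. y' s * cnj (y s))
    (\<lambda>s. of_real ((norm (y' s))\<^sup>2) - \<kappa>\<^sup>2 * of_real (\<epsilon> s * (norm (y s))\<^sup>2))"
proof -
  have eq: "(\<lambda>s. - \<kappa>\<^sup>2 * of_real (\<epsilon> s) * y s * cnj (y s) + y' s * cnj (y' s)) =
      (\<lambda>s. of_real ((norm (y' s))\<^sup>2) - \<kappa>\<^sup>2 * of_real (\<epsilon> s * (norm (y s))\<^sup>2))"
    by (simp add: fun_eq_iff mult.assoc complex_norm_square del: of_real_power)
  show ?thesis
    using W1inf_loc_mult[OF solvesD(2)[OF assms] W1inf_loc_cnj[OF solvesD(1)[OF assms]]]
    unfolding eq .
qed

text \<open>
  The lower bound: \<open>Im (y' cnj y)\<close> is \<open>0\<close> at the origin and has derivative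
  \<open>- Im (\<kappa>\<^sup>2) \<epsilon> |y|\<^sup>2 \<ge> 0\<close>. If it were still \<open>0\<close> at \<open>b\<close>, then \<open>y\<close> would vanish on \<open>[0, b]\<close>,
  against \<open>y' 0 \<noteq> 0\<close>.
\<close>

lemma solves_rotates:
  assumes sol: "solves \<kappa> \<epsilon> y y'" and neg: "Im (\<kappa>\<^sup>2) < 0"
    and m: "0 < m" "AE s in lebesgue. m \<le> \<epsilon> s" and init: "y 0 = 0" "y' 0 \<noteq> 0" and b: "0 < b"
  shows "0 < Im (y' b * cnj (y b))"
proof (rule ccontr)
  assume "\<not> 0 < Im (y' b * cnj (y b))"
  define c where "c = - Im (\<kappa>\<^sup>2) * m"
  have c: "0 < c" using mult_neg_pos[OF neg m(1)] by (simp add: c_def)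
  have cont: "continuous_on {0..b} (\<lambda>s. c * (norm (y s))\<^sup>2)"
    by (intro continuous_intros W1inf_loc_continuous[OF solvesD(1)[OF sol]])
  have "((\<lambda>s. c * (norm (y s))\<^sup>2) has_integral integral {0..b} (\<lambda>s. c * (norm (y s))\<^sup>2)) {0..b}"
    by (intro integrable_integral integrable_continuous_real cont)
  moreover have "((\<lambda>s. Im (of_real ((norm (y' s))\<^sup>2) - \<kappa>\<^sup>2 * of_real (\<epsilon> s * (norm (y s))\<^sup>2))) has_integral
      Im (y' b * cnj (y b) - y' 0 * cnj (y 0))) {0..b}"
    using b by (intro has_integral_Im W1inf_loc_integral[OF solves_W1inf_loc_flux[OF sol]]) simp
  moreover have "AE s in lebesgue. s \<in> {0..b} \<longrightarrow> c * (norm (y s))\<^sup>2 \<le>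
      Im (of_real ((norm (y' s))\<^sup>2) - \<kappa>\<^sup>2 * of_real (\<epsilon> s * (norm (y s))\<^sup>2))"
    using m(2)
  proof eventually_elim
    case (elim s)
    have "- Im (\<kappa>\<^sup>2) * (m * (norm (y s))\<^sup>2) \<le> - Im (\<kappa>\<^sup>2) * (\<epsilon> s * (norm (y s))\<^sup>2)"
      using elim neg by (intro mult_left_mono mult_right_mono) auto
    then show ?case by (simp add: c_def mult.assoc)
  qed
  ultimately have "integral {0..b} (\<lambda>s. c * (norm (y s))\<^sup>2) \<le> Im (y' b * cnj (y b) - y' 0 * cnj (y 0))"
    by (rule integral_mono_AE)
  also have "\<dots> \<le> 0"
    using \<open>\<not> 0 < Im (y' b * cnj (y b))\<close> init by simp
  finally have "integral {0..b} (\<lambda>s. c * (norm (y s))\<^sup>2) = 0"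
    using c by (intro antisym integral_nonneg integrable_continuous_real cont) auto
  then have zero: "y s = 0" if "s \<in> {0..b}" for s
    using integral_eq_0_iff[OF cont b] c that by auto
  have "((\<lambda>s. Re (cnj (y' 0) * y s)) has_real_derivative Re (cnj (y' 0) * y' 0)) (at 0)"
    by (rule solves_real_derivatives[OF sol])
  moreover have "0 < Re (cnj (y' 0) * y' 0)"
    using init(2) complex_neq_0[of "y' 0"] by (simp add: power2_eq_square)
  ultimately obtain d where d: "0 < d" "\<And>h. \<lbrakk>0 < h; h < d\<rbrakk> \<Longrightarrow> Re (cnj (y' 0) * y 0) < Re (cnj (y' 0) * y (0 + h))"
    using DERIV_pos_inc_right by blast
  define h where "h = min (d / 2) b"
  have "0 < h" "h < d" "h \<in> {0..b}"
    using d(1) b by (auto simp: h_def)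
  from d(2)[OF this(1,2)] zero[OF this(3)] init show False by simp
qed

text \<open>
  The upper bound: \<open>Im (\<kappa>\<^sup>2 y cnj y')\<close> is \<open>0\<close> at the origin and has derivative
  \<open>Im (\<kappa>\<^sup>2) |y'|\<^sup>2 \<le> 0\<close>. For \<open>\<kappa>\<^sup>2\<close> of argument \<open>- 2 \<phi>\<close>, and \<open>y' / y\<close> in the upper half plane, the
  conclusion says that the argument of \<open>y' / y\<close> is at most \<open>\<pi> - 2 \<phi>\<close>.
\<close>

lemma solves_log_derivative_sector:
  assumes sol: "solves \<kappa> \<epsilon> y y'" and neg: "Im (\<kappa>\<^sup>2) \<le> 0" and init: "y 0 = 0" and b: "0 \<le> b"
  shows "Im (\<kappa>\<^sup>2 * (y b * cnj (y' b))) \<le> 0"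
proof -
  have W: "W1inf_loc (\<lambda>s. - \<kappa>\<^sup>2 * cnj (y' s * cnj (y s)))
      (\<lambda>s. - \<kappa>\<^sup>2 * cnj (of_real ((norm (y' s))\<^sup>2) - \<kappa>\<^sup>2 * of_real (\<epsilon> s * (norm (y s))\<^sup>2)))"
    by (intro W1inf_loc_cmult W1inf_loc_cnj solves_W1inf_loc_flux[OF sol])
  have "Im (- \<kappa>\<^sup>2 * cnj (y' 0 * cnj (y 0))) \<le> Im (- \<kappa>\<^sup>2 * cnj (y' b * cnj (y b)))"
  proof (rule W1inf_loc_Im_nondecreasing[OF W b], rule AE_I2, rule impI)
    fix s
    have "Im (\<kappa>\<^sup>2) * (norm (y' s))\<^sup>2 \<le> 0"
      using neg by (intro mult_nonpos_nonneg) auto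
    moreover have "- \<kappa>\<^sup>2 * cnj (of_real ((norm (y' s))\<^sup>2) - \<kappa>\<^sup>2 * of_real (\<epsilon> s * (norm (y s))\<^sup>2))
        = - \<kappa>\<^sup>2 * of_real ((norm (y' s))\<^sup>2) + (\<kappa>\<^sup>2 * cnj (\<kappa>\<^sup>2)) * of_real (\<epsilon> s * (norm (y s))\<^sup>2)"
      by (simp add: algebra_simps)
    then have "- \<kappa>\<^sup>2 * cnj (of_real ((norm (y' s))\<^sup>2) - \<kappa>\<^sup>2 * of_real (\<epsilon> s * (norm (y s))\<^sup>2))
        = - \<kappa>\<^sup>2 * of_real ((norm (y' s))\<^sup>2) + of_real ((norm (\<kappa>\<^sup>2))\<^sup>2 * (\<epsilon> s * (norm (y s))\<^sup>2))"
      by (simp only: complex_norm_square[symmetric] of_real_mult)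
    ultimately show "0 \<le> Im (- \<kappa>\<^sup>2 * cnj (of_real ((norm (y' s))\<^sup>2) - \<kappa>\<^sup>2 * of_real (\<epsilon> s * (norm (y s))\<^sup>2)))"
      by simp
  qed
  then show ?thesis
    using init by (simp add: mult.commute)
qed

text \<open>
  The energy \<open>|y|\<^sup>2 + |y'|\<^sup>2\<close> grows at most at the exponential rate \<open>1 + |\<kappa>|\<^sup>2 M\<close>.
\<close>

lemma solves_unique:
  assumes sol: "solves \<kappa> \<epsilon> y y'" and M: "AE s in lebesgue. \<bar>\<epsilon> s\<bar> \<le> M"
    and init: "y 0 = 0" "y' 0 = 0" and b: "0 \<le> b"
  shows "y b = 0"
proof -
  \<comment> \<open>The factor \<open>- \<i>\<close> below turns the negative of a real part into an imaginary part, so that the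
    monotonicity lemma for imaginary parts applies.\<close>
  define K where "K = 1 + (norm \<kappa>)\<^sup>2 * M"
  let ?E = "\<lambda>s. y s * cnj (y s) + y' s * cnj (y' s)"
  let ?e = "\<lambda>s. exp (- of_real (K * s)) :: complex"
  let ?E' = "\<lambda>s. (y' s * cnj (y s) + y s * cnj (y' s)) +
    ((- \<kappa>\<^sup>2 * of_real (\<epsilon> s) * y s) * cnj (y' s) + y' s * cnj (- \<kappa>\<^sup>2 * of_real (\<epsilon> s) * y s))"
  have W: "W1inf_loc ?E ?E'"
    by (intro W1inf_loc_add W1inf_loc_mult W1inf_loc_cnj solvesD[OF sol])
  have We: "W1inf_loc ?e (\<lambda>s. - of_real K * ?e s)"
  proof (rule W1inf_loc_C1)
    fix s :: real
    have "((\<lambda>z. exp (- (of_real K * z))) has_field_derivative (- of_real K * exp (- (of_real K * of_real s))))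
        (at (of_real s :: complex))"
      by (auto intro!: derivative_eq_intros)
    from has_vector_derivative_real_field[OF this]
    show "(?e has_vector_derivative - of_real K * ?e s) (at s)"
      by simp
  qed (intro continuous_intros)
  have W2: "W1inf_loc (\<lambda>s. - \<i> * (?E s * ?e s)) (\<lambda>s. - \<i> * (?E' s * ?e s + ?E s * (- of_real K * ?e s)))"
    by (rule W1inf_loc_cmult[OF W1inf_loc_mult[OF W We]])
  have "Im (- \<i> * (?E 0 * ?e 0)) \<le> Im (- \<i> * (?E b * ?e b))"
  proof (rule W1inf_loc_Im_nondecreasing[OF W2 b])
    show "AE s in lebesgue. s \<in> {0..b} \<longrightarrow>
        0 \<le> Im (- \<i> * (?E' s * ?e s + ?E s * (- of_real K * ?e s)))"
      using M
    proof eventually_elim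
      case (elim s)
      have e: "?e s = of_real (exp (- K * s))"
        by (simp add: exp_of_real[symmetric])
      have E: "?E s = of_real ((norm (y s))\<^sup>2 + (norm (y' s))\<^sup>2)"
        by (simp add: complex_norm_square del: of_real_power)
      have Kpos: "0 \<le> K"
        using elim by (simp add: K_def)
      have "Re (?E' s) \<le> norm (?E' s)"
        by (rule complex_Re_le_cmod)
      also have "\<dots> \<le> (norm (y' s) * norm (y s) + norm (y s) * norm (y' s)) +
          ((norm \<kappa>)\<^sup>2 * \<bar>\<epsilon> s\<bar> * norm (y s) * norm (y' s) + norm (y' s) * ((norm \<kappa>)\<^sup>2 * \<bar>\<epsilon> s\<bar> * norm (y s)))"
        by (intro norm_triangle_mono) (simp_all add: norm_mult norm_power)
      also have "\<dots> = (1 + (norm \<kappa>)\<^sup>2 * \<bar>\<epsilon> s\<bar>) * (2 * norm (y s) * norm (y' s))"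
        by (simp add: algebra_simps)
      also have "\<dots> \<le> K * (2 * norm (y s) * norm (y' s))"
        unfolding K_def using elim by (intro mult_right_mono add_left_mono mult_left_mono) auto
      also have "\<dots> \<le> K * ((norm (y s))\<^sup>2 + (norm (y' s))\<^sup>2)"
        by (intro mult_left_mono sum_squares_bound Kpos)
      finally have "Re (?E' s) * exp (- K * s) \<le> K * ((norm (y s))\<^sup>2 + (norm (y' s))\<^sup>2) * exp (- K * s)"
        by (rule mult_right_mono) simp
      then show ?case
        unfolding e E by (simp add: algebra_simps)
    qed
  qed
  moreover have "Im (- \<i> * (?E 0 * ?e 0)) = 0"
    using init by simp
  ultimately have nonneg: "0 \<le> Im (- \<i> * (?E b * ?e b))"
    by (simp only:)
  have eq: "?E b * ?e b = of_real (((norm (y b))\<^sup>2 + (norm (y' b))\<^sup>2) * exp (- K * b))"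
    by (simp add: complex_norm_square exp_of_real[symmetric] del: of_real_power)
  have "((norm (y b))\<^sup>2 + (norm (y' b))\<^sup>2) * exp (- K * b) \<le> 0"
    using nonneg unfolding eq by simp
  then have "(norm (y b))\<^sup>2 + (norm (y' b))\<^sup>2 \<le> 0"
    by (simp add: mult_le_0_iff)
  then show ?thesis
    using sum_power2_le_zero_iff[of "norm (y b)" "norm (y' b)"] by simp
qed

lemma solves_log_derivative:
  assumes sol: "solves \<kappa> \<epsilon> y y'" and neg: "Im (\<kappa>\<^sup>2) < 0"
    and m: "0 < m" "AE s in lebesgue. m \<le> \<epsilon> s" and init: "y 0 = 0" "y' 0 = 1" and s: "0 < s"
  shows "0 < Im (y' s / y s)" "Im (\<kappa>\<^sup>2 * cnj (y' s / y s)) \<le> 0" "y s \<noteq> 0"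
proof -
  have pos: "0 < Im (y' s * cnj (y s))"
    using solves_rotates[OF sol neg m init(1) _ s] init(2) by simp
  show nz: "y s \<noteq> 0"
    using pos by auto
  have n: "0 < (norm (y s))\<^sup>2"
    using nz by simp
  have q: "y' s / y s = y' s * cnj (y s) / of_real ((norm (y s))\<^sup>2)"
    using complex_div_cnj[of "y' s" "y s"] by simp
  have "Im (y' s / y s) = Im (y' s * cnj (y s)) / (norm (y s))\<^sup>2"
    unfolding q by (simp only: Im_divide_of_real)
  then show "0 < Im (y' s / y s)"
    using pos n by simp
  have "\<kappa>\<^sup>2 * cnj (y' s / y s) = \<kappa>\<^sup>2 * (y s * cnj (y' s)) / of_real ((norm (y s))\<^sup>2)"
    unfolding q by (simp add: mult.commute)
  then have "Im (\<kappa>\<^sup>2 * cnj (y' s / y s)) = Im (\<kappa>\<^sup>2 * (y s * cnj (y' s))) / (norm (y s))\<^sup>2"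
    by (simp only: Im_divide_of_real)
  moreover have "Im (\<kappa>\<^sup>2 * (y s * cnj (y' s))) \<le> 0"
    using solves_log_derivative_sector[OF sol _ init(1)] neg s by simp
  ultimately show "Im (\<kappa>\<^sup>2 * cnj (y' s / y s)) \<le> 0"
    using n by (simp only: divide_nonpos_pos)
qed

section \<open>Comparison with a constant coefficient\<close>

lemma solves_constant_derivative:
  assumes "solves \<kappa> (\<lambda>_. M) Y Y'"
  shows "(Y' has_vector_derivative (- \<kappa>\<^sup>2 * of_real M * Y s)) (at s)"
    "continuous_on UNIV (\<lambda>s. - \<kappa>\<^sup>2 * of_real M * Y s)"
proof -
  show c: "continuous_on UNIV (\<lambda>s. - \<kappa>\<^sup>2 * of_real M * Y s)"
    by (intro continuous_intros W1inf_loc_continuous[OF solvesD(1)[OF assms]])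
  show "(Y' has_vector_derivative (- \<kappa>\<^sup>2 * of_real M * Y s)) (at s)"
    using W1inf_loc_DERIV[OF solvesD(2)[OF assms] c] .
qed

text \<open>
  When \<open>Y\<close> has value \<open>0\<close> and slope \<open>1\<close> at the origin, this function of \<open>t\<close> is the value at \<open>s\<close> of the
  solution that follows \<open>\<epsilon>\<close> up to \<open>t\<close> and the constant coefficient \<open>M\<close> from \<open>t\<close> to \<open>s\<close>. It would be
  constant if \<open>\<epsilon>\<close> were \<open>M\<close>, so its derivative carries the factor \<open>M - \<epsilon>\<close>.
\<close>

lemma solves_switch_W1inf_loc:
  assumes y: "solves \<kappa> \<epsilon> y y'" and Y: "solves \<kappa> (\<lambda>_. M) Y Y'"
  shows "W1inf_loc (\<lambda>t. y t * Y' (s - t) + y' t * Y (s - t))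
    (\<lambda>t. \<kappa>\<^sup>2 * of_real (M - \<epsilon> t) * (y t * Y (s - t)))"
proof -
  have 1: "W1inf_loc (\<lambda>t. Y (s - t)) (\<lambda>t. - Y' (s - t))"
    by (rule W1inf_loc_reversed[OF solvesD(3)[OF Y] W1inf_loc_continuous[OF solvesD(2)[OF Y]]])
  have 2: "W1inf_loc (\<lambda>t. Y' (s - t)) (\<lambda>t. - (- \<kappa>\<^sup>2 * of_real M * Y (s - t)))"
    by (rule W1inf_loc_reversed[OF solves_constant_derivative[OF Y]])
  have eq: "(\<lambda>t. (y' t * Y' (s - t) + y t * (- (- \<kappa>\<^sup>2 * of_real M * Y (s - t)))) +
      ((- \<kappa>\<^sup>2 * of_real (\<epsilon> t) * y t) * Y (s - t) + y' t * (- Y' (s - t)))) =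
      (\<lambda>t. \<kappa>\<^sup>2 * of_real (M - \<epsilon> t) * (y t * Y (s - t)))"
    by (rule ext) (simp add: algebra_simps)
  show ?thesis
    using W1inf_loc_add[OF W1inf_loc_mult[OF solvesD(1)[OF y] 2] W1inf_loc_mult[OF solvesD(2)[OF y] 1]]
    unfolding eq .
qed

text \<open>
  The step of the continuation argument. The switching curve \<open>P\<close> leads from \<open>Y s\<close> to \<open>y s\<close>.
  Writing \<open>P t = y t * Y (s - t) * (y' t / y t + Y' (s - t) / Y (s - t))\<close>, the three factors have
  arguments in \<open>(0, \<phi>)\<close>, \<open>(0, \<phi>)\<close> and \<open>(0, \<pi> - 2 \<phi>]\<close>, so \<open>P\<close> stays in the upper half plane. The same
  bounds on logarithmic derivatives show that it turns clockwise.
\<close>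

lemma sector_step:
  assumes \<kappa>: "0 < Re \<kappa>" "Im \<kappa> < 0"
    and y: "solves \<kappa> \<epsilon> y y'" "y 0 = 0" "y' 0 = 1"
    and Y: "solves \<kappa> (\<lambda>_. M) Y Y'" "Y 0 = 0" "Y' 0 = 1"
    and m: "0 < m" "AE s in lebesgue. m \<le> \<epsilon> s" and M: "AE s in lebesgue. \<epsilon> s \<le> M" "m \<le> M"
    and s: "0 < s" and ysec: "\<And>t. \<lbrakk>0 < t; t < s\<rbrakk> \<Longrightarrow> y t \<in> sector \<kappa>"
    and Ysec: "\<And>t. \<lbrakk>0 < t; t \<le> s\<rbrakk> \<Longrightarrow> Y t \<in> sector \<kappa>" and up: "0 < Im (y s)"
  shows "y s \<in> sector \<kappa>"
proof -
  have neg: "Im (\<kappa>\<^sup>2) < 0"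
    by (rule fourth_quadrant_square[OF \<kappa>])
  have mM: "AE s in lebesgue. m \<le> M"
    using M(2) by simp
  define P where "P = (\<lambda>t. y t * Y' (s - t) + y' t * Y (s - t))"
  have "Im (P s * cnj (P 0)) \<le> 0"
    unfolding P_def
  proof (rule W1inf_loc_turns_clockwise[OF solves_switch_W1inf_loc[OF y(1) Y(1)]])
    show "0 \<le> s" using s by simp
    fix t assume t: "t \<in> {0..s}"
    consider "t = 0" | "t = s" | "0 < t" "t < s" using t by fastforce
    then show "0 < Im (y t * Y' (s - t) + y' t * Y (s - t))"
    proof cases
      case 1
      then show ?thesis using y Ysec[of s] s by (simp add: sector_def)
    next
      case 2
      then show ?thesis using Y up by simp
    next
      case 3
      let ?w = "y' t / y t + Y' (s - t) / Y (s - t)"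
      note ly = solves_log_derivative[OF y(1) neg m y(2,3) 3(1)]
      have st: "0 < s - t" using 3 by simp
      note lY = solves_log_derivative[OF Y(1) neg m(1) mM Y(2,3) st]
      have "y t * Y' (s - t) + y' t * Y (s - t) = y t * Y (s - t) * ?w"
        using ly(3) lY(3) by (simp add: field_simps)
      moreover have "0 < Im (y t * Y (s - t) * ?w)"
      proof (rule sector_triple_product[OF \<kappa> ysec[OF 3] Ysec])
        show "0 < Im ?w"
          using ly(1) lY(1) by (simp only: plus_complex.simps add_pos_pos)
        have "\<kappa>\<^sup>2 * cnj ?w = \<kappa>\<^sup>2 * cnj (y' t / y t) + \<kappa>\<^sup>2 * cnj (Y' (s - t) / Y (s - t))"
          by (simp only: complex_cnj_add distrib_left)
        then show "Im (\<kappa>\<^sup>2 * cnj ?w) \<le> 0"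
          using ly(2) lY(2) by (simp only: plus_complex.simps add_nonpos_nonpos)
      qed (use 3 in auto)
      ultimately show ?thesis by (simp only:)
    qed
  next
    show "AE t in lebesgue. t \<in> {0..s} \<longrightarrow>
        Im (\<kappa>\<^sup>2 * of_real (M - \<epsilon> t) * (y t * Y (s - t)) *
          cnj (y t * Y' (s - t) + y' t * Y (s - t))) \<le> 0"
      using M(1)
    proof eventually_elim
      case (elim t)
      show ?case
      proof
        assume t: "t \<in> {0..s}"
        \<comment> \<open>Expanding \<open>P' cnj P\<close> separates the contributions of the two logarithmic derivatives.\<close>
        have "\<kappa>\<^sup>2 * of_real (M - \<epsilon> t) * (y t * Y (s - t)) * cnj (y t * Y' (s - t) + y' t * Y (s - t))
          = of_real (M - \<epsilon> t) * (of_real ((norm (y t))\<^sup>2) * (\<kappa>\<^sup>2 * (Y (s - t) * cnj (Y' (s - t))))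
             + of_real ((norm (Y (s - t)))\<^sup>2) * (\<kappa>\<^sup>2 * (y t * cnj (y' t))))"
          unfolding complex_norm_square by (simp add: algebra_simps)
        then have "Im (\<kappa>\<^sup>2 * of_real (M - \<epsilon> t) * (y t * Y (s - t)) * cnj (y t * Y' (s - t) + y' t * Y (s - t)))
          = (M - \<epsilon> t) * ((norm (y t))\<^sup>2 * Im (\<kappa>\<^sup>2 * (Y (s - t) * cnj (Y' (s - t))))
             + (norm (Y (s - t)))\<^sup>2 * Im (\<kappa>\<^sup>2 * (y t * cnj (y' t))))"
          by (simp only: Im_complex_of_real Re_complex_of_real times_complex.simps plus_complex.simps
              mult_zero_left add_0_right)
        also have "\<dots> \<le> 0"
          using elim t neg solves_log_derivative_sector[OF y(1) _ y(2)]
            solves_log_derivative_sector[OF Y(1) _ Y(2)]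
          by (intro mult_nonneg_nonpos add_nonpos_nonpos) auto
        finally show "Im (\<kappa>\<^sup>2 * of_real (M - \<epsilon> t) * (y t * Y (s - t)) *
          cnj (y t * Y' (s - t) + y' t * Y (s - t))) \<le> 0" .
      qed
    qed
  qed
  then have "Im (y s * cnj (Y s)) \<le> 0"
    using y(2,3) Y(2,3) by (simp add: P_def)
  then show ?thesis
    by (intro sector_clockwise[OF \<kappa> Ysec up]) (use s in auto)
qed

text \<open>
  Near the origin \<open>y s\<close> behaves like \<open>s\<close>, a boundary ray of the sector. One side of the sector is
  therefore seen from the first derivative, while \<open>0 < Im (y s)\<close> needs the equation: there
  \<open>- \<kappa>\<^sup>2 y\<close> lies in the upper half plane, hence \<open>Im y'\<close> and \<open>Im y\<close> are nonnegative, and the rotation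
  of \<open>y\<close> makes the inequality strict.
\<close>

lemma sector_near_zero:
  assumes \<kappa>: "0 < Re \<kappa>" "Im \<kappa> < 0"
    and y: "solves \<kappa> \<epsilon> y y'" "y 0 = 0" "y' 0 = 1"
    and m: "0 < m" "AE s in lebesgue. m \<le> \<epsilon> s"
  obtains d where "0 < d" "\<And>s. \<lbrakk>0 < s; s < d\<rbrakk> \<Longrightarrow> y s \<in> sector \<kappa>"
proof -
  have neg: "Im (\<kappa>\<^sup>2) < 0"
    by (rule fourth_quadrant_square[OF \<kappa>])
  obtain d1 where d1: "0 < d1" "\<And>h. \<lbrakk>0 < h; h < d1\<rbrakk> \<Longrightarrow> 0 < Re (y h)"
    using DERIV_pos_inc_right[OF solves_real_derivatives(1)[OF y(1), of 1 0]] y by auto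
  obtain d2 where d2: "0 < d2" "\<And>h. \<lbrakk>0 < h; h < d2\<rbrakk> \<Longrightarrow> Im (\<kappa> * y h) < 0"
    using DERIV_neg_dec_right[OF solves_real_derivatives(2)[OF y(1), of \<kappa> 0]] y \<kappa> by auto
  \<comment> \<open>On this interval \<open>y''\<close>, a positive multiple of \<open>- \<kappa>\<^sup>2 y\<close>, points into the upper half plane.\<close>
  obtain d3 where d3: "0 < d3" "\<And>h. \<lbrakk>0 < h; h < d3\<rbrakk> \<Longrightarrow> 0 < Im (- \<kappa>\<^sup>2 * y h)"
    using DERIV_pos_inc_right[OF solves_real_derivatives(2)[OF y(1), of "- \<kappa>\<^sup>2" 0]] y neg by auto
  define d where "d = min d1 (min d2 d3)"
  have ge0: "0 \<le> Im (y s)" if s: "0 < s" "s < d" for s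
  proof -
    have "0 \<le> Im (y' t)" if t: "0 \<le> t" "t \<le> s" for t
    proof -
      have "Im (y' 0) \<le> Im (y' t)"
      proof (rule W1inf_loc_Im_nondecreasing[OF solvesD(2)[OF y(1)] t(1)])
        show "AE r in lebesgue. r \<in> {0..t} \<longrightarrow> 0 \<le> Im (- \<kappa>\<^sup>2 * of_real (\<epsilon> r) * y r)"
          using m(2)
        proof eventually_elim
          case (elim r)
          show ?case
          proof
            assume r: "r \<in> {0..t}"
            have "0 \<le> Im (- \<kappa>\<^sup>2 * y r)"
              using d3(2)[of r] r t s y(2) by (cases "r = 0") (auto simp: d_def)
            then have "0 \<le> \<epsilon> r * Im (- \<kappa>\<^sup>2 * y r)"
              using elim m(1) by (intro mult_nonneg_nonneg) auto
            also have "\<dots> = Im (- \<kappa>\<^sup>2 * of_real (\<epsilon> r) * y r)"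
              by (simp add: algebra_simps)
            finally show "0 \<le> Im (- \<kappa>\<^sup>2 * of_real (\<epsilon> r) * y r)" .
          qed
        qed
      qed
      then show ?thesis using y by simp
    qed
    then have "Im (y 0) \<le> Im (y s)"
      by (intro W1inf_loc_Im_nondecreasing[OF solvesD(1)[OF y(1)]]) (use s in auto)
    then show ?thesis using y by simp
  qed
  show ?thesis
  proof (rule that[of d])
    show "0 < d" using d1 d2 d3 by (simp add: d_def)
    fix s assume s: "0 < s" "s < d"
    have "Im (y (s / 2)) / Re (y (s / 2)) < Im (y s) / Re (y s)"
    proof (rule rotating_curve_slope_increasing[OF solvesD(3)[OF y(1)]])
      show "0 < Re (y t)" if "t \<in> {s / 2..s}" for t
        using that s by (intro d1(2)) (auto simp: d_def)
      show "0 < Im (y' t * cnj (y t))" if "t \<in> {s / 2<..<s}" for t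
        using that s y(3) by (intro solves_rotates[OF y(1) neg m y(2)]) auto
    qed (use s in auto)
    moreover have "0 \<le> Im (y (s / 2)) / Re (y (s / 2))"
      using ge0[of "s / 2"] d1(2)[of "s / 2"] s by (intro divide_nonneg_nonneg) (auto simp: d_def)
    ultimately have "0 < Im (y s) / Re (y s)" by linarith
    then have "0 < Im (y s)"
      using d1(2)[of s] s by (simp add: d_def zero_less_divide_iff)
    then show "y s \<in> sector \<kappa>"
      using d2(2)[of s] s by (simp add: sector_def d_def)
  qed
qed

text \<open>
  At the first exit point \<open>s1\<close> the solution lies in the closure of the sector. It has been turning
  counterclockwise, so it is not on the real axis, and \<open>sector_step\<close> puts it back into the open
  sector.
\<close>

lemma solves_stays_in_sector:
  assumes \<kappa>: "0 < Re \<kappa>" "Im \<kappa> < 0"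
    and y: "solves \<kappa> \<epsilon> y y'" "y 0 = 0" "y' 0 = 1"
    and Y: "solves \<kappa> (\<lambda>_. M) Y Y'" "Y 0 = 0" "Y' 0 = 1"
    and m: "0 < m" "AE s in lebesgue. m \<le> \<epsilon> s" and M: "AE s in lebesgue. \<epsilon> s \<le> M" "m \<le> M"
    and Ysec: "\<And>t. \<lbrakk>0 < t; t < S\<rbrakk> \<Longrightarrow> Y t \<in> sector \<kappa>" and s: "0 < s" "s < S"
  shows "y s \<in> sector \<kappa>"
proof (rule ccontr)
  assume "y s \<notin> sector \<kappa>"
  define bad where "bad = {t. 0 < t \<and> t < S \<and> y t \<notin> sector \<kappa>}"
  have neg: "Im (\<kappa>\<^sup>2) < 0"
    by (rule fourth_quadrant_square[OF \<kappa>])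
  have sbad: "s \<in> bad"
    using \<open>y s \<notin> sector \<kappa>\<close> s by (simp add: bad_def)
  have bdd: "bdd_below bad"
    by (rule bdd_belowI[of _ 0]) (simp add: bad_def)
  define s1 where "s1 = Inf bad"
  have s1s: "s1 \<le> s"
    unfolding s1_def using bdd sbad by (rule cInf_lower[rotated])
  obtain d where d: "0 < d" "\<And>t. \<lbrakk>0 < t; t < d\<rbrakk> \<Longrightarrow> y t \<in> sector \<kappa>"
    using sector_near_zero[OF \<kappa> y m] by blast
  have "d \<le> s1"
    unfolding s1_def using sbad d(2) by (intro cInf_greatest) (auto simp: bad_def not_less[symmetric])
  then have s1: "0 < s1" "s1 < S"
    using d(1) s1s s(2) by auto
  have good: "y t \<in> sector \<kappa>" if "0 < t" "t < s1" for t
  proof (rule ccontr)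
    assume "y t \<notin> sector \<kappa>"
    then have "t \<in> bad" using that s1 by (simp add: bad_def)
    then have "s1 \<le> t" unfolding s1_def using bdd by (rule cInf_lower)
    with that show False by simp
  qed
  have cont: "continuous_on UNIV y"
    by (rule W1inf_loc_continuous[OF solvesD(1)[OF y(1)]])
  have lim: "(y \<longlongrightarrow> y s1) (at_left s1)"
    using cont by (simp add: continuous_on_eq_continuous_at isCont_def filterlim_at_split)
  have ev: "eventually (\<lambda>t. y t \<in> sector \<kappa>) (at_left s1)"
    unfolding eventually_at_left[OF s1(1)] using good s1(1) by (intro exI[of _ 0]) auto
  have "0 \<le> Im (y s1)"
    by (rule tendsto_lowerbound[OF tendsto_Im[OF lim]]) (use ev in \<open>auto simp: sector_def elim: eventually_mono\<close>)
  moreover have "Im (\<kappa> * y s1) \<le> 0"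
    by (rule tendsto_upperbound[OF tendsto_Im[OF tendsto_mult_left[OF lim]]])
      (use ev in \<open>auto simp: sector_def elim: eventually_mono\<close>)
  moreover have "y s1 \<noteq> 0"
    by (rule solves_log_derivative(3)[OF y(1) neg m y(2,3) s1(1)])
  ultimately have Re1: "0 < Re (y s1)"
    by (rule sector_closure_Re_pos[OF \<kappa>])
  have Repos: "0 < Re (y t)" if "0 < t" "t \<le> s1" for t
  proof (cases "t = s1")
    case False
    then have "y t \<in> sector \<kappa>" using that good by simp
    then show ?thesis
      by (intro sector_closure_Re_pos[OF \<kappa>]) (auto simp: sector_def)
  qed (use Re1 in simp)
  have slope: "Im (y (s1 / 2)) / Re (y (s1 / 2)) < Im (y s1) / Re (y s1)"
  proof (rule rotating_curve_slope_increasing[OF solvesD(3)[OF y(1)]])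
    show "0 < Re (y t)" if "t \<in> {s1 / 2..s1}" for t
      using that s1 by (intro Repos) auto
    show "0 < Im (y' t * cnj (y t))" if "t \<in> {s1 / 2<..<s1}" for t
      using that s1 y(3) by (intro solves_rotates[OF y(1) neg m y(2)]) auto
  qed (use s1 in auto)
  have "0 < Im (y (s1 / 2)) / Re (y (s1 / 2))"
    using Repos[of "s1 / 2"] good[of "s1 / 2"] s1 by (intro divide_pos_pos) (auto simp: sector_def)
  with slope have "0 < Im (y s1) / Re (y s1)" by linarith
  then have "0 < Im (y s1)"
    using Repos[of s1] s1 by (simp add: zero_less_divide_iff)
  then have "y s1 \<in> sector \<kappa>"
    using good Ysec s1 by (intro sector_step[OF \<kappa> y Y m M s1(1)]) auto
  moreover have "(y \<longlongrightarrow> y s1) (nhds s1)"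
    using cont by (simp add: continuous_on_eq_continuous_at isCont_def tendsto_at_iff_tendsto_nhds)
  ultimately have "eventually (\<lambda>t. y t \<in> sector \<kappa>) (nhds s1)"
    using topological_tendstoD[OF _ open_sector] by blast
  then obtain e where e: "0 < e" "\<And>t. dist t s1 < e \<Longrightarrow> y t \<in> sector \<kappa>"
    unfolding eventually_nhds_metric by blast
  have "s1 + e \<le> t" if "t \<in> bad" for t
  proof (rule ccontr)
    assume "\<not> s1 + e \<le> t"
    moreover have "s1 \<le> t"
      unfolding s1_def using that bdd by (rule cInf_lower)
    ultimately show False
      using e(2)[of t] that by (auto simp: dist_real_def bad_def)
  qed
  then have "s1 + e \<le> s1"
    unfolding s1_def[symmetric] using sbad by (subst (2) s1_def, intro cInf_greatest) auto
  then show False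
    using e(1) by simp
qed

text \<open>
  The Wronskian \<open>y Y' - y' Y\<close> has derivative \<open>- \<kappa>\<^sup>2 (M - \<epsilon>) y Y\<close> and vanishes at \<open>0\<close> and at \<open>S\<close>.
  Hence the nonnegative function \<open>(M - \<epsilon>) Im (y Y)\<close> has integral \<open>0\<close>, and \<open>Im (y Y)\<close> is
  positive inside the interval.
\<close>

lemma matching_solutions_imp_coefficient_eq:
  assumes \<kappa>: "0 < Re \<kappa>" "Im \<kappa> < 0"
    and y: "solves \<kappa> \<epsilon> y y'" "y 0 = 0" "y' 0 = 1"
    and Y: "solves \<kappa> (\<lambda>_. M) Y Y'" "Y 0 = 0" "Y' 0 = 1"
    and m: "0 < m" "AE s in lebesgue. m \<le> \<epsilon> s" and M: "AE s in lebesgue. \<epsilon> s \<le> M" "m \<le> M"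
    and Ysec: "\<And>t. \<lbrakk>0 < t; t < S\<rbrakk> \<Longrightarrow> Y t \<in> sector \<kappa>" and S: "0 < S"
    and bc: "y' S = c * y S" "Y' S = c * Y S"
  shows "AE s in lebesgue. s \<in> {0..S} \<longrightarrow> \<epsilon> s = M"
proof -
  have k2: "\<kappa>\<^sup>2 \<noteq> 0"
    using \<kappa> by auto
  define f where "f = (\<lambda>s. of_real (M - \<epsilon> s) * (y s * Y s) :: complex)"
  have eq: "(\<lambda>s. (y' s * Y' s + y s * (- \<kappa>\<^sup>2 * of_real M * Y s)) -
      ((- \<kappa>\<^sup>2 * of_real (\<epsilon> s) * y s) * Y s + y' s * Y' s)) = (\<lambda>s. - \<kappa>\<^sup>2 * f s)"
    by (rule ext) (simp add: f_def algebra_simps)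
  have W: "W1inf_loc (\<lambda>s. y s * Y' s - y' s * Y s) (\<lambda>s. - \<kappa>\<^sup>2 * f s)"
    using W1inf_loc_diff[OF W1inf_loc_mult[OF solvesD(1)[OF y(1)] solvesD(2)[OF Y(1)]]
        W1inf_loc_mult[OF solvesD(2)[OF y(1)] solvesD(1)[OF Y(1)]]] unfolding eq .
  have "W1inf_loc (\<lambda>s. - (1 / \<kappa>\<^sup>2) * (y s * Y' s - y' s * Y s)) (\<lambda>s. - (1 / \<kappa>\<^sup>2) * (- \<kappa>\<^sup>2 * f s))"
    by (rule W1inf_loc_cmult[OF W])
  moreover have "(\<lambda>s. - (1 / \<kappa>\<^sup>2) * (- \<kappa>\<^sup>2 * f s)) = f"
    using k2 by simp
  ultimately have Wf: "W1inf_loc (\<lambda>s. - (1 / \<kappa>\<^sup>2) * (y s * Y' s - y' s * Y s)) f"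
    by simp
  have "(f has_integral 0) {0..S}"
    using W1inf_loc_integral[OF Wf, of 0 S] S y Y bc by simp
  then have int0: "integral {0..S} (\<lambda>s. Im (f s)) = 0"
    using has_integral_Im[of f 0 "{0..S}"] by (simp add: integral_unique)
  have int: "integrable (lebesgue_on {0..S}) (\<lambda>s. Im (f s))"
    by (intro integrable_Im Linf_loc_integrable W1inf_loc_Linf_loc[OF Wf])
  have sign: "0 < Im (y s * Y s)" if "s \<in> {0..S}" "s \<noteq> 0" "s \<noteq> S" for s
  proof (rule sector_product[OF \<kappa>])
    have s: "0 < s" "s < S" using that by auto
    then show "Y s \<in> sector \<kappa>" by (rule Ysec)
    show "y s \<in> sector \<kappa>"
      by (rule solves_stays_in_sector[OF \<kappa> y Y m M Ysec s])
  qed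
  have ne: "AE s in lebesgue. s \<noteq> (0::real)" "AE s in lebesgue. s \<noteq> S"
    by (intro AE_completion AE_lborel_singleton)+
  have pos: "AE s in lebesgue_on {0..S}. 0 \<le> Im (f s)"
  proof (subst AE_restrict_space_iff)
    show "AE s in lebesgue. s \<in> {0..S} \<longrightarrow> 0 \<le> Im (f s)"
      using M(1) ne
    proof eventually_elim
      case (elim s)
      show ?case
      proof
        assume "s \<in> {0..S}"
        then have "0 \<le> (M - \<epsilon> s) * Im (y s * Y s)"
          using elim sign[of s] by (intro mult_nonneg_nonneg) auto
        then show "0 \<le> Im (f s)"
          by (simp add: f_def)
      qed
    qed
  qed auto
  have "integral\<^sup>L (lebesgue_on {0..S}) (\<lambda>s. Im (f s)) = 0"
    using lebesgue_integral_eq_integral[OF int] int0 by simp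
  then have "AE s in lebesgue_on {0..S}. Im (f s) = 0"
    using integral_nonneg_eq_0_iff_AE[OF int pos] by simp
  then have "AE s in lebesgue. s \<in> {0..S} \<longrightarrow> Im (f s) = 0"
    by (subst (asm) AE_restrict_space_iff) auto
  then show ?thesis
    using ne
  proof eventually_elim
    case (elim s)
    show ?case
    proof
      assume s: "s \<in> {0..S}"
      have "Im (f s) = (M - \<epsilon> s) * Im (y s * Y s)"
        by (simp add: f_def)
      then have "(M - \<epsilon> s) * Im (y s * Y s) = 0"
        using elim s by simp
      moreover have "0 < Im (y s * Y s)"
        using sign[of s] elim s by simp
      ultimately show "\<epsilon> s = M" by simp
    qed
  qed
qed

section \<open>The shortest interval of a symmetric profile\<close>

text \<open>
  The infimum need not belong to \<open>B\<close>; it is approached by a sequence in \<open>B\<close>, and countably many null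
  sets make a null set.
\<close>

lemma const_outside_Inf:
  fixes B :: "real set" and \<epsilon> :: "real \<Rightarrow> real"
  assumes "B \<noteq> {}" "bdd_below B" "\<And>b. b \<in> B \<Longrightarrow> AE s in lebesgue. b < s \<longrightarrow> \<epsilon> s = (c::real)"
  shows "AE s in lebesgue. Inf B < s \<longrightarrow> \<epsilon> s = c"
proof -
  have "\<forall>i::nat. \<exists>b. b \<in> B \<and> b < Inf B + 1 / real (Suc i)"
  proof
    fix i :: nat
    have "Inf B < Inf B + 1 / real (Suc i)" by simp
    then show "\<exists>b. b \<in> B \<and> b < Inf B + 1 / real (Suc i)"
      using cInf_less_iff[OF assms(1,2)] by blast
  qed
  then obtain b where b: "\<And>i::nat. b i \<in> B" "\<And>i. b i < Inf B + 1 / real (Suc i)"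
    by metis
  have "AE s in lebesgue. \<forall>i::nat. b i < s \<longrightarrow> \<epsilon> s = c"
    unfolding AE_all_countable using assms(3) b(1) by blast
  then show ?thesis
  proof eventually_elim
    case (elim s)
    show ?case
    proof
      assume "Inf B < s"
      then obtain i :: nat where "1 / real (Suc i) < s - Inf B"
        using nat_approx_posE[of "s - Inf B"] by auto
      with b(2)[of i] have "b i < s" by linarith
      with elim show "\<epsilon> s = c" by blast
    qed
  qed
qed

lemma const_outside_halves:
  "const_outside n \<epsilon> a b \<longleftrightarrow> a \<le> b \<and> (AE s in lebesgue. s < a \<longrightarrow> \<epsilon> s = n\<^sup>2) \<and>
    (AE s in lebesgue. b < s \<longrightarrow> \<epsilon> s = n\<^sup>2)"
proof -
  have "(\<forall>s. (s \<notin> {a..b} \<longrightarrow> \<epsilon> s = n\<^sup>2) \<longleftrightarrow> (s < a \<longrightarrow> \<epsilon> s = n\<^sup>2) \<and> (b < s \<longrightarrow> \<epsilon> s = n\<^sup>2))"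
    by auto
  then show ?thesis
    unfolding const_outside_def by (simp add: AE_conj_iff)
qed

text \<open>
  For a symmetric profile the intervals outside of which \<open>\<epsilon> = n\<^sup>2\<close> are stable under reflection, so the infimum \<open>t\<close>
  of their right ends determines the left end as well. The interval \<open>[- t, t]\<close> is contained in
  every other one, which is stronger than being shortest and gives uniqueness.
\<close>

lemma shortest_interval_symmetric:
  assumes c: "const_outside n \<epsilon> a0 b0" and nc: "\<not> (AE s in lebesgue. \<epsilon> s = n\<^sup>2)"
    and sym: "AE s in lebesgue. \<epsilon> s = \<epsilon> (- s)"
  shows "\<exists>t. shortest_interval n \<epsilon> = (- t, t) \<and> const_outside n \<epsilon> (- t) t \<and>
    (\<forall>a b. const_outside n \<epsilon> a b \<longrightarrow> a \<le> - t \<and> t \<le> b)"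
proof -
  have refl: "const_outside n \<epsilon> (- b) (- a)" if "const_outside n \<epsilon> a b" for a b
  proof -
    have "AE s in lebesgue. - s \<notin> {a..b} \<longrightarrow> \<epsilon> (- s) = n\<^sup>2"
      using AE_lebesgue_reflect that unfolding const_outside_def by blast
    then have "AE s in lebesgue. s \<notin> {- b..- a} \<longrightarrow> \<epsilon> s = n\<^sup>2"
      using sym by eventually_elim auto
    then show ?thesis
      using that by (simp add: const_outside_def)
  qed
  \<comment> \<open>An interval to the left of the origin is disjoint from its mirror image, so outside of one of
    the two means everywhere.\<close>
  have cross: "0 \<le> b" if cab: "const_outside n \<epsilon> a b" for a b
  proof (rule ccontr)
    assume "\<not> 0 \<le> b"
    have "AE s in lebesgue. b < s \<longrightarrow> \<epsilon> s = n\<^sup>2" "AE s in lebesgue. s < - b \<longrightarrow> \<epsilon> s = n\<^sup>2"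
      using cab refl[OF cab] unfolding const_outside_halves by auto
    then have "AE s in lebesgue. \<epsilon> s = n\<^sup>2"
    proof eventually_elim
      case (elim s)
      show ?case
        using elim \<open>\<not> 0 \<le> b\<close> by (cases "b < s") auto
    qed
    with nc show False ..
  qed
  define B where "B = {b. \<exists>a. const_outside n \<epsilon> a b}"
  define t where "t = Inf B"
  have B: "B \<noteq> {}" "bdd_below B"
    using c cross unfolding B_def by (auto intro!: bdd_belowI[of _ 0])
  have t0: "0 \<le> t"
    unfolding t_def using B(1) cross by (intro cInf_greatest) (auto simp: B_def)
  have right: "AE s in lebesgue. t < s \<longrightarrow> \<epsilon> s = n\<^sup>2"
    unfolding t_def by (rule const_outside_Inf[OF B]) (auto simp: B_def const_outside_halves)
  have "AE s in lebesgue. s < - t \<longrightarrow> \<epsilon> s = n\<^sup>2"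
    using AE_lebesgue_reflect[OF right] sym by eventually_elim auto
  then have ct: "const_outside n \<epsilon> (- t) t"
    using right t0 unfolding const_outside_halves by auto
  have le: "a \<le> - t \<and> t \<le> b" if cab: "const_outside n \<epsilon> a b" for a b
  proof -
    have "b \<in> B" "- a \<in> B"
      using cab refl[OF cab] by (auto simp: B_def)
    then have "t \<le> b" "t \<le> - a"
      unfolding t_def using B(2) by (auto intro: cInf_lower)
    then show ?thesis by simp
  qed
  have "shortest_interval n \<epsilon> = (- t, t)"
    unfolding shortest_interval_def
  proof (rule the_equality)
    show "case (- t, t) of (s, t) \<Rightarrow> const_outside n \<epsilon> s t \<and>
        (\<forall>a b. const_outside n \<epsilon> a b \<longrightarrow> t - s \<le> b - a)"
      using ct le by (auto dest!: le)
    fix p assume "case p of (s, t) \<Rightarrow> const_outside n \<epsilon> s t \<and>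
        (\<forall>a b. const_outside n \<epsilon> a b \<longrightarrow> t - s \<le> b - a)"
    then obtain s' t' where p: "p = (s', t')" "const_outside n \<epsilon> s' t'"
      "\<And>a b. const_outside n \<epsilon> a b \<Longrightarrow> t' - s' \<le> b - a"
      by (cases p) auto
    show "p = (- t, t)"
      using p(1) p(3)[OF ct] le[OF p(2)] by simp
  qed
  with ct le show ?thesis by blast
qed

lemma const_outside_cong_AE:
  assumes "AE s in lebesgue. \<epsilon> s = \<epsilon>' s"
  shows "const_outside n \<epsilon> a b \<longleftrightarrow> const_outside n \<epsilon>' a b"
proof -
  have "(AE s in lebesgue. s \<notin> {a..b} \<longrightarrow> \<epsilon> s = n\<^sup>2) \<longleftrightarrow> (AE s in lebesgue. s \<notin> {a..b} \<longrightarrow> \<epsilon>' s = n\<^sup>2)"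
    by (rule eventually_cong[OF assms]) simp
  then show ?thesis
    by (simp add: const_outside_def)
qed

lemma res_length_cong_AE:
  assumes "AE s in lebesgue. \<epsilon> s = \<epsilon>' s"
  shows "res_length n \<epsilon> = res_length n \<epsilon>'"
proof -
  have "shortest_interval n \<epsilon> = shortest_interval n \<epsilon>'"
    unfolding shortest_interval_def const_outside_cong_AE[OF assms] ..
  moreover have "(AE s in lebesgue. \<epsilon> s = n\<^sup>2) \<longleftrightarrow> (AE s in lebesgue. \<epsilon>' s = n\<^sup>2)"
    by (rule eventually_cong[OF assms]) simp
  ultimately show ?thesis
    by (simp add: res_length_def)
qed

lemma short_imp_const_outside:
  assumes "\<epsilon> \<in> F_sym n1 n2 n" "res_length n \<epsilon> \<le> 2 * S" "0 < S"
  shows "const_outside n \<epsilon> (- S) S"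
proof (cases "AE s in lebesgue. \<epsilon> s = n\<^sup>2")
  case True
  then have "AE s in lebesgue. s \<notin> {- S..S} \<longrightarrow> \<epsilon> s = n\<^sup>2"
    by (auto elim: eventually_mono)
  then show ?thesis
    using assms(3) by (simp add: const_outside_def)
next
  case False
  obtain a b where "const_outside n \<epsilon> a b"
    using assms(1) unfolding F_sym_def by blast
  moreover have "AE s in lebesgue. \<epsilon> s = \<epsilon> (- s)"
    using assms(1) unfolding F_sym_def by blast
  ultimately obtain t where t: "shortest_interval n \<epsilon> = (- t, t)" "const_outside n \<epsilon> (- t) t"
    using shortest_interval_symmetric[OF _ False] by blast
  have "t \<le> S"
    using assms(2) False by (simp add: res_length_def t(1))
  have "AE s in lebesgue. s \<notin> {- t..t} \<longrightarrow> \<epsilon> s = n\<^sup>2"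
    using t(2) by (simp add: const_outside_def)
  then have "AE s in lebesgue. s \<notin> {- S..S} \<longrightarrow> \<epsilon> s = n\<^sup>2"
    by eventually_elim (use \<open>t \<le> S\<close> in auto)
  then show ?thesis
    using assms(3) by (simp add: const_outside_def)
qed

lemma F_sym_bounds:
  assumes "0 < n1" "n1 \<le> n" "n < n2" "\<epsilon> \<in> F_sym n1 n2 n"
  shows "AE s in lebesgue. n1\<^sup>2 \<le> \<epsilon> s" "AE s in lebesgue. \<epsilon> s \<le> n2\<^sup>2"
proof -
  obtain a b where ab: "AE s in lebesgue. s \<notin> {a..b} \<longrightarrow> \<epsilon> s = n\<^sup>2"
    "AE s in lebesgue. s \<in> {a<..<b} \<longrightarrow> n1\<^sup>2 \<le> \<epsilon> s \<and> \<epsilon> s \<le> n2\<^sup>2"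
    using assms(4) unfolding F_sym_def const_outside_def by blast
  have n: "n1\<^sup>2 \<le> n\<^sup>2" "n\<^sup>2 \<le> n2\<^sup>2"
    using assms by (auto intro!: power_mono)
  have "AE s in lebesgue. n1\<^sup>2 \<le> \<epsilon> s \<and> \<epsilon> s \<le> n2\<^sup>2"
    using ab AE_neq[of a] AE_neq[of b]
  proof eventually_elim
    case (elim s)
    then show ?case using n by (cases "s \<in> {a..b}") auto
  qed
  then show "AE s in lebesgue. n1\<^sup>2 \<le> \<epsilon> s" "AE s in lebesgue. \<epsilon> s \<le> n2\<^sup>2"
    by (auto elim: eventually_mono)
qed

section \<open>The boundary value problem on the right half of the interval\<close>

text \<open>
  Where \<open>\<epsilon> = n\<^sup>2\<close>, the equation factors as \<open>(D + d) (D - d) y = 0\<close> with \<open>d = \<i> \<kappa> n\<close>. So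
  \<open>(y' - d y) exp (d s)\<close> is constant between \<open>b\<close> and \<open>S\<close>, and it is \<open>0\<close> at \<open>b\<close>.
\<close>

lemma outgoing_condition_transfer:
  assumes sol: "solves \<kappa> \<epsilon> y y'" and c: "const_outside n \<epsilon> a b" "const_outside n \<epsilon> a' S"
    and bc: "y' b = \<i> * \<kappa> * of_real n * y b"
  shows "y' S = \<i> * \<kappa> * of_real n * y S"
proof -
  define d where "d = \<i> * \<kappa> * of_real n"
  define e where "e = (\<lambda>s. exp (d * of_real s))"
  define g where "g = (\<lambda>s. (y' s - d * y s) * e s)"
  have d2: "d * d = - \<kappa>\<^sup>2 * of_real (n\<^sup>2)"
    by (simp add: d_def power2_eq_square algebra_simps)
  have We: "W1inf_loc e (\<lambda>s. d * e s)"
  proof (rule W1inf_loc_C1)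
    fix s :: real
    have "((\<lambda>z. exp (d * z)) has_field_derivative (d * exp (d * of_real s))) (at (of_real s))"
      by (auto intro!: derivative_eq_intros)
    from has_vector_derivative_real_field[OF this]
    show "(e has_vector_derivative d * e s) (at s)"
      by (simp add: e_def)
  next
    show "continuous_on UNIV (\<lambda>s. d * e s)"
      unfolding e_def by (intro continuous_intros)
  qed
  have eq: "(\<lambda>s. (- \<kappa>\<^sup>2 * of_real (\<epsilon> s) * y s - d * y' s) * e s + (y' s - d * y s) * (d * e s)) =
      (\<lambda>s. (- \<kappa>\<^sup>2 * of_real (\<epsilon> s) - d * d) * (y s * e s))"
    by (rule ext) (simp add: algebra_simps)
  have W: "W1inf_loc g (\<lambda>s. (- \<kappa>\<^sup>2 * of_real (\<epsilon> s) - d * d) * (y s * e s))"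
    using W1inf_loc_mult[OF W1inf_loc_diff[OF solvesD(2)[OF sol] W1inf_loc_cmult[OF solvesD(1)[OF sol], of d]] We]
    unfolding eq g_def .
  have "AE s in lebesgue. s \<in> {min b S..max b S} \<longrightarrow>
      (- \<kappa>\<^sup>2 * of_real (\<epsilon> s) - d * d) * (y s * e s) = 0"
    using c(1)[unfolded const_outside_halves, THEN conjunct2, THEN conjunct2]
      c(2)[unfolded const_outside_halves, THEN conjunct2, THEN conjunct2] AE_neq[of b] AE_neq[of S]
  proof eventually_elim
    case (elim s)
    show ?case
    proof
      assume "s \<in> {min b S..max b S}"
      then have "\<epsilon> s = n\<^sup>2"
        using elim by (auto simp: min_def max_def split: if_splits)
      then show "(- \<kappa>\<^sup>2 * of_real (\<epsilon> s) - d * d) * (y s * e s) = 0"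
        unfolding d2 by simp
    qed
  qed
  then have "g (min b S) = g (max b S)"
    by (intro W1inf_loc_zero_derivative[OF W]) auto
  then have "g S = g b"
    by (cases "b \<le> S") (auto simp: min_def max_def)
  moreover have "g b = 0"
    using bc by (simp add: g_def d_def)
  ultimately have "y' S - d * y S = 0"
    by (simp add: g_def e_def)
  then show ?thesis
    by (simp add: d_def)
qed

text \<open>
  A nontrivial odd solution has a nonzero slope at the origin by uniqueness for the initial value
  problem, so the slope can be scaled to \<open>1\<close>.
\<close>

lemma Sigma_odd_normalized_solution:
  assumes \<kappa>: "\<kappa> \<in> Sigma_odd n \<epsilon>" and \<epsilon>: "\<epsilon> \<in> borel_measurable lebesgue"
    and M: "AE s in lebesgue. \<bar>\<epsilon> s\<bar> \<le> M" and S: "const_outside n \<epsilon> a' S"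
  obtains y y' where "solves \<kappa> \<epsilon> y y'" "y 0 = 0" "y' 0 = 1" "y' S = \<i> * \<kappa> * of_real n * y S"
proof -
  obtain y y' y'' a b where y: "W1inf_loc y y'" "W1inf_loc y' y''" "\<exists>s. y s \<noteq> 0" "\<And>s. y (- s) = - y s"
    "AE s in lebesgue. y'' s = - \<kappa>\<^sup>2 * of_real (\<epsilon> s) * y s" "const_outside n \<epsilon> a b"
    "y' b / \<kappa> = \<i> * of_real n * y b" and "\<kappa> \<noteq> 0"
    using \<kappa> unfolding Sigma_odd_def W2inf_loc_def by blast
  have meas: "(\<lambda>s. - \<kappa>\<^sup>2 * of_real (\<epsilon> s) * y s) \<in> borel_measurable lebesgue"
    using \<epsilon> Linf_loc_continuous[OF W1inf_loc_continuous[OF y(1)]] unfolding Linf_loc_def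
    by (intro borel_measurable_times borel_measurable_of_real borel_measurable_const) auto
  have sol: "solves \<kappa> \<epsilon> y y'"
    unfolding solves_def using y(1) W1inf_loc_cong_AE[OF y(2,5) meas] by blast
  have y0: "y 0 = 0"
    using y(4)[of 0] by simp
  have y'0: "y' 0 \<noteq> 0"
  proof
    assume "y' 0 = 0"
    then have nonneg: "y s = 0" if "0 \<le> s" for s
      using solves_unique[OF sol M y0 _ that] by simp
    have "y s = 0" for s
      using nonneg[of s] nonneg[of "- s"] y(4)[of s] by (cases "0 \<le> s") auto
    with y(3) show False by blast
  qed
  have "y' b = \<i> * \<kappa> * of_real n * y b"
    using y(7) \<open>\<kappa> \<noteq> 0\<close> by (simp add: field_simps)
  then have bc: "y' S = \<i> * \<kappa> * of_real n * y S"
    by (rule outgoing_condition_transfer[OF sol y(6) S])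
  show ?thesis
  proof (rule that[OF solves_scale[OF sol, of "1 / y' 0"]])
    show "1 / y' 0 * y' S = \<i> * \<kappa> * of_real n * (1 / y' 0 * y S)"
      using bc by simp
  qed (use y0 y'0 in auto)
qed

section \<open>The single layer\<close>

lemma has_vector_derivative_sin_cos:
  "((\<lambda>s. sin (k * of_real s)) has_vector_derivative k * cos (k * of_real s)) (at s)"
  "((\<lambda>s. cos (k * of_real s)) has_vector_derivative - k * sin (k * of_real s)) (at s)"
  for k :: complex
proof -
  have "((\<lambda>z. sin (k * z)) has_field_derivative k * cos (k * of_real s)) (at (of_real s))"
    by (auto intro!: derivative_eq_intros)
  from has_vector_derivative_real_field[OF this]
  show "((\<lambda>s. sin (k * of_real s)) has_vector_derivative k * cos (k * of_real s)) (at s)" .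
  have "((\<lambda>z. cos (k * z)) has_field_derivative - k * sin (k * of_real s)) (at (of_real s))"
    by (auto intro!: derivative_eq_intros)
  from has_vector_derivative_real_field[OF this]
  show "((\<lambda>s. cos (k * of_real s)) has_vector_derivative - k * sin (k * of_real s)) (at s)" .
qed

lemma sine_solves:
  assumes "k \<noteq> 0" "k\<^sup>2 = \<kappa>\<^sup>2 * of_real M"
  shows "solves \<kappa> (\<lambda>_. M) (\<lambda>s. sin (k * of_real s) / k) (\<lambda>s. cos (k * of_real s))"
  unfolding solves_def
proof
  have "((\<lambda>s. sin (k * of_real s) / k) has_vector_derivative cos (k * of_real s)) (at s)" for s
    using bounded_linear.has_vector_derivative[OF bounded_linear_divide[of k] has_vector_derivative_sin_cos(1)[of k s]]
      assms(1) by simp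
  then show "W1inf_loc (\<lambda>s. sin (k * of_real s) / k) (\<lambda>s. cos (k * of_real s))"
    by (rule W1inf_loc_C1) (intro continuous_intros)
  have eq: "(\<lambda>s. - \<kappa>\<^sup>2 * of_real M * (sin (k * of_real s) / k)) = (\<lambda>s. - k * sin (k * of_real s))"
  proof
    fix s :: real
    have "- \<kappa>\<^sup>2 * of_real M * (sin (k * of_real s) / k) = - (k\<^sup>2) * (sin (k * of_real s) / k)"
      unfolding assms(2) by simp
    also have "\<dots> = - k * sin (k * of_real s)"
      using assms(1) by (simp add: power2_eq_square)
    finally show "- \<kappa>\<^sup>2 * of_real M * (sin (k * of_real s) / k) = - k * sin (k * of_real s)" .
  qed
  show "W1inf_loc (\<lambda>s. cos (k * of_real s)) (\<lambda>s. - \<kappa>\<^sup>2 * of_real M * (sin (k * of_real s) / k))"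
    unfolding eq by (rule W1inf_loc_C1[OF has_vector_derivative_sin_cos(2)]) (intro continuous_intros)
qed

lemma Im_sin_cosh: "Im (sin z) = cos (Re z) * sinh (Im z)" "Re (sin z) = sin (Re z) * cosh (Im z)"
  by (simp_all add: Im_sin Re_sin sinh_def cosh_def)

text \<open>
  Multiplication by \<open>\<kappa>\<close> leaves a sine of a number in the fourth quadrant, whose imaginary part is
  explicit. The imaginary part of the quotient itself is, up to a positive factor, the function \<open>F\<close>
  below; it is \<open>0\<close> at the origin, and in its derivative the mixed terms cancel.
\<close>

lemma sine_in_sector:
  assumes \<kappa>: "0 < Re \<kappa>" "Im \<kappa> < 0" and n: "0 < n" and s: "0 < s" "Re \<kappa> * (n * s) < pi / 2"
  shows "sin (\<kappa> * of_real n * of_real s) / (\<kappa> * of_real n) \<in> sector \<kappa>"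
proof -
  define a b u where "a = Re \<kappa>" and "b = Im \<kappa>" and "u = n * s"
  let ?z = "\<kappa> * of_real n * of_real s"
  have z: "Re ?z = a * u" "Im ?z = b * u"
    by (simp_all add: a_def b_def u_def)
  have ab: "0 < a" "b < 0" "0 < u" "a * u < pi / 2"
    using \<kappa> n s by (auto simp: a_def b_def u_def)
  have nz: "\<kappa> \<noteq> 0" using \<kappa> by auto
  have "\<kappa> * (sin ?z / (\<kappa> * of_real n)) = sin ?z / of_real n"
    using nz n by simp
  moreover have "Im (sin ?z) < 0"
    unfolding Im_sin_cosh z using ab by (intro mult_pos_neg cos_gt_zero_pi) (auto simp: mult_neg_pos intro: order_less_trans[OF _ mult_pos_pos])
  ultimately have 1: "Im (\<kappa> * (sin ?z / (\<kappa> * of_real n))) < 0"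
    using n by (simp only: Im_divide_of_real divide_neg_pos)
  define F where "F = (\<lambda>t. a * (cos (a * t) * sinh (b * t)) - b * (sin (a * t) * cosh (b * t)))"
  have "F 0 < F u"
  proof (rule DERIV_pos_imp_increasing_open[OF ab(3)])
    fix t assume t: "0 < t" "t < u"
    have "(F has_real_derivative - (a\<^sup>2 + b\<^sup>2) * (sin (a * t) * sinh (b * t))) (at t)"
      unfolding F_def by (auto intro!: derivative_eq_intros simp: algebra_simps power2_eq_square)
    moreover have "sin (a * t) * sinh (b * t) < 0"
    proof (intro mult_pos_neg sin_gt_zero)
      have "a * t < a * u" using ab t by simp
      then show "a * t < pi" using ab(4) pi_gt_zero by linarith
    qed (use ab t in \<open>auto simp: mult_neg_pos\<close>)
    then have "0 < - (a\<^sup>2 + b\<^sup>2) * (sin (a * t) * sinh (b * t))"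
      using ab sum_power2_gt_zero_iff[of a b] by (intro mult_neg_neg) auto
    ultimately show "\<exists>y. (F has_real_derivative y) (at t) \<and> 0 < y" by blast
  next
    show "continuous_on {0..u} F"
      unfolding F_def by (intro continuous_intros)
  qed
  then have F: "0 < F u" by (simp add: F_def)
  have "sin ?z / (\<kappa> * of_real n) = sin ?z * cnj \<kappa> / of_real (n * (norm \<kappa>)\<^sup>2)"
    unfolding of_real_mult complex_norm_square using nz n by (simp add: field_simps)
  then have "Im (sin ?z / (\<kappa> * of_real n)) = Im (sin ?z * cnj \<kappa>) / (n * (norm \<kappa>)\<^sup>2)"
    by (simp only: Im_divide_of_real)
  also have "Im (sin ?z * cnj \<kappa>) = F u"
    unfolding F_def times_complex.simps Im_sin_cosh z complex_cnj by (simp add: a_def b_def u_def algebra_simps)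
  finally have "0 < Im (sin ?z / (\<kappa> * of_real n))"
    using F n nz by simp
  with 1 show ?thesis by (simp only: sector_def mem_Collect_eq)
qed

definition layer :: "real \<Rightarrow> real \<Rightarrow> real \<Rightarrow> real \<Rightarrow> real" where
  "layer S n2 n s = (if s \<in> {- S..S} then n2\<^sup>2 else n\<^sup>2)"

lemma layer_measurable: "layer S n2 n \<in> borel_measurable lebesgue"
proof -
  have "(\<lambda>s. if s \<in> {- S..S} then n2\<^sup>2 else n\<^sup>2) \<in> borel_measurable lborel"
    by measurable
  then show ?thesis
    unfolding layer_def[abs_def] by (rule measurable_completion)
qed

text \<open>
  The resonant state is a sine inside the layer and an outgoing exponential outside. Clamping \<open>s\<close> to
  \<open>[- S, S]\<close> writes both in one formula, for \<open>y\<close> and for \<open>y'\<close>, and continuity is then evident; the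
  resonance condition is what makes the formula for \<open>y'\<close> the derivative of \<open>y\<close> outside the layer.
\<close>

lemma layer_in_Sigma_odd:
  assumes \<kappa>: "\<kappa> \<noteq> 0" and S: "0 < S" and n2: "0 < n2"
    and res: "of_real n2 * cos (\<kappa> * of_real n2 * of_real S) = \<i> * of_real n * sin (\<kappa> * of_real n2 * of_real S)"
  shows "\<kappa> \<in> Sigma_odd n (layer S n2 n)"
proof -
  define k c where "k = \<kappa> * of_real n2" and "c = \<i> * \<kappa> * of_real n"
  have kc: "k * cos (k * of_real S) = c * sin (k * of_real S)"
    using res by (simp add: k_def c_def)
  have c2: "c * c = - \<kappa>\<^sup>2 * of_real (n\<^sup>2)" and k2: "k * k = \<kappa>\<^sup>2 * of_real (n2\<^sup>2)"
    by (simp_all add: c_def k_def power2_eq_square algebra_simps)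
  define cl where "cl = (\<lambda>s. max (- S) (min S s))"
  define E where "E = (\<lambda>s. exp (c * of_real (max 0 (\<bar>s\<bar> - S))))"
  define y where "y = (\<lambda>s. sin (k * of_real (cl s)) * E s)"
  define y' where "y' = (\<lambda>s. k * cos (k * of_real (cl s)) * E s)"
  define y'' where "y'' = (\<lambda>s. - \<kappa>\<^sup>2 * of_real (layer S n2 n s) * y s)"
  have cont: "continuous_on UNIV y" "continuous_on UNIV y'"
    unfolding y_def y'_def cl_def E_def by (intro continuous_intros)+
  have dexp: "((\<lambda>s. A * exp (d * of_real (s - r))) has_vector_derivative d * (A * exp (d * of_real (s - r)))) (at s)"
    for A d :: complex and r s :: real
  proof -
    have "((\<lambda>z. A * exp (d * (z - of_real r))) has_field_derivative d * (A * exp (d * (of_real s - of_real r)))) (at (of_real s))"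
      by (auto intro!: derivative_eq_intros)
    from has_vector_derivative_real_field[OF this] show ?thesis by simp
  qed
  have inner: "y s = sin (k * of_real s)" "y' s = k * cos (k * of_real s)" if "s \<in> {- S<..<S}" for s
    using that by (auto simp: y_def y'_def cl_def E_def)
  have right: "y s = sin (k * of_real S) * exp (c * of_real (s - S))"
    "y' s = c * (sin (k * of_real S) * exp (c * of_real (s - S)))" if "s \<in> {S<..}" for s
  proof -
    have "cl s = S" "max 0 (\<bar>s\<bar> - S) = s - S"
      using that S by (auto simp: cl_def)
    then show "y s = sin (k * of_real S) * exp (c * of_real (s - S))"
      "y' s = c * (sin (k * of_real S) * exp (c * of_real (s - S)))"
      by (simp_all only: y_def y'_def E_def kc flip: mult.assoc)
  qed
  have left: "y s = - sin (k * of_real S) * exp (- c * of_real (s - - S))"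
    "y' s = - c * (- sin (k * of_real S) * exp (- c * of_real (s - - S)))" if "s \<in> {..<- S}" for s
  proof -
    have cl: "cl s = - S" "max 0 (\<bar>s\<bar> - S) = - (s - - S)"
      using that S by (auto simp: cl_def)
    have "c * of_real (- (s - - S)) = - c * of_real (s - - S)"
      by (simp add: algebra_simps)
    then have E: "E s = exp (- c * of_real (s - - S))"
      by (simp only: E_def cl)
    show "y s = - sin (k * of_real S) * exp (- c * of_real (s - - S))"
      "y' s = - c * (- sin (k * of_real S) * exp (- c * of_real (s - - S)))"
      unfolding y_def y'_def E cl using kc by simp_all
  qed
  have D: "(y has_vector_derivative y' s) (at s)" "(y' has_vector_derivative y'' s) (at s)"
    if ends: "s \<notin> {- S, S}" for s
  proof -
    consider "s \<in> {- S<..<S}" | "s \<in> {S<..}" | "s \<in> {..<- S}"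
      using ends by fastforce
    then have "(y has_vector_derivative y' s) (at s) \<and> (y' has_vector_derivative y'' s) (at s)"
    proof cases
      case 1
      have "(y has_vector_derivative k * cos (k * of_real s)) (at s)"
        by (rule has_vector_derivative_transform_within_open[OF has_vector_derivative_sin_cos(1) open_greaterThanLessThan 1])
          (simp add: inner)
      moreover have "((\<lambda>s. k * cos (k * of_real s)) has_vector_derivative k * (- k * sin (k * of_real s))) (at s)"
        by (rule bounded_linear.has_vector_derivative[OF bounded_linear_mult_right has_vector_derivative_sin_cos(2)])
      then have "(y' has_vector_derivative k * (- k * sin (k * of_real s))) (at s)"
        by (rule has_vector_derivative_transform_within_open[OF _ open_greaterThanLessThan 1])
          (simp add: inner)
      moreover have "y'' s = k * (- k * sin (k * of_real s))"
        using 1 k2 by (simp add: y''_def inner[OF 1] layer_def flip: mult.assoc)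
      ultimately show ?thesis using inner[OF 1] by simp
    next
      case 2
      have "(y has_vector_derivative c * (sin (k * of_real S) * exp (c * of_real (s - S)))) (at s)"
        by (rule has_vector_derivative_transform_within_open[OF dexp open_greaterThan 2])
          (simp add: right)
      moreover have "((\<lambda>s. c * (sin (k * of_real S) * exp (c * of_real (s - S)))) has_vector_derivative
          c * (c * (sin (k * of_real S) * exp (c * of_real (s - S))))) (at s)"
        by (rule bounded_linear.has_vector_derivative[OF bounded_linear_mult_right dexp])
      then have "(y' has_vector_derivative c * (c * (sin (k * of_real S) * exp (c * of_real (s - S))))) (at s)"
        by (rule has_vector_derivative_transform_within_open[OF _ open_greaterThan 2]) (simp add: right)
      moreover have "y'' s = c * (c * (sin (k * of_real S) * exp (c * of_real (s - S))))"
        using 2 c2 by (simp add: y''_def right[OF 2] layer_def flip: mult.assoc)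
      ultimately show ?thesis using right[OF 2] by simp
    next
      case 3
      have "(y has_vector_derivative - c * (- sin (k * of_real S) * exp (- c * of_real (s - - S)))) (at s)"
        by (rule has_vector_derivative_transform_within_open[OF dexp open_lessThan 3])
          (simp add: left)
      moreover have "((\<lambda>s. - c * (- sin (k * of_real S) * exp (- c * of_real (s - - S)))) has_vector_derivative
          - c * (- c * (- sin (k * of_real S) * exp (- c * of_real (s - - S))))) (at s)"
        by (rule bounded_linear.has_vector_derivative[OF bounded_linear_mult_right dexp])
      then have "(y' has_vector_derivative - c * (- c * (- sin (k * of_real S) * exp (- c * of_real (s - - S))))) (at s)"
        by (rule has_vector_derivative_transform_within_open[OF _ open_lessThan 3]) (simp add: left)
      moreover have "y'' s = - c * (- c * (- sin (k * of_real S) * exp (- c * of_real (s - - S))))"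
      proof -
        have "layer S n2 n s = n\<^sup>2" using 3 by (auto simp: layer_def)
        then have "y'' s = (c * c) * y s"
          unfolding c2 y''_def by simp
        then show ?thesis unfolding left(1)[OF 3] by simp
      qed
      ultimately show ?thesis using left[OF 3] by simp
    qed
    then show "(y has_vector_derivative y' s) (at s)" "(y' has_vector_derivative y'' s) (at s)"
      by blast+
  qed
  have Lay: "Linf_loc (\<lambda>s. of_real (layer S n2 n s) :: complex)"
    unfolding Linf_loc_def
  proof (intro conjI allI)
    show "(\<lambda>s. of_real (layer S n2 n s) :: complex) \<in> borel_measurable lebesgue"
      by (rule measurable_compose[OF layer_measurable borel_measurable_of_real])
    show "\<exists>C. AE s in lebesgue. s \<in> {a..b} \<longrightarrow> norm (of_real (layer S n2 n s) :: complex) \<le> C" for a b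
      by (intro exI[of _ "n2\<^sup>2 + n\<^sup>2"] AE_I2) (auto simp: layer_def simp del: of_real_power)
  qed
  have L'': "Linf_loc y''"
    unfolding y''_def
    by (intro Linf_loc_mult Lay Linf_loc_continuous[OF cont(1)] Linf_loc_continuous continuous_intros)
  have W: "W2inf_loc y y' y''"
    unfolding W2inf_loc_def
    using W1inf_loc_piecewise[of "{- S, S}" y y'] W1inf_loc_piecewise[of "{- S, S}" y' y'']
      cont D L'' Linf_loc_continuous[OF cont(2)] by auto
  have odd: "y (- s) = - y s" for s
  proof -
    have "cl (- s) = - cl s" "E (- s) = E s"
      using S by (auto simp: cl_def E_def min_def max_def)
    then show ?thesis by (simp add: y_def)
  qed
  have ends: "y S = sin (k * of_real S)" "y' S = c * sin (k * of_real S)"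
    "y (- S) = - sin (k * of_real S)" "y' (- S) = c * sin (k * of_real S)"
    using S kc by (simp_all add: y_def y'_def cl_def E_def)
  have nonzero: "\<exists>s. y s \<noteq> 0"
  proof (rule ccontr)
    assume "\<not> (\<exists>s. y s \<noteq> 0)"
    then have y0: "y = (\<lambda>s. 0)" by auto
    have "(y has_vector_derivative k) (at 0)"
      using D(1)[of 0] S inner(2)[of 0] by simp
    moreover have "(y has_vector_derivative 0) (at 0)"
      unfolding y0 by simp
    ultimately have "k = 0"
      by (rule vector_derivative_unique_at)
    with \<kappa> n2 show False by (simp add: k_def)
  qed
  have co: "const_outside n (layer S n2 n) (- S) S"
    using S by (auto simp: const_outside_def layer_def intro!: AE_I2)
  have bc: "y' (- S) / \<kappa> = - \<i> * of_real n * y (- S)" "y' S / \<kappa> = \<i> * of_real n * y S"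
    using \<kappa> unfolding ends c_def by simp_all
  show ?thesis
    unfolding Sigma_odd_def mem_Collect_eq
  proof (rule conjI[OF \<kappa>], rule exI[of _ y], rule exI[of _ y'], rule exI[of _ y''],
      rule exI[of _ "- S"], rule exI[of _ S], intro conjI allI W nonzero odd co bc)
    show "AE s in lebesgue. y'' s = - \<kappa>\<^sup>2 * of_real (layer S n2 n s) * y s"
      by (simp add: y''_def)
  qed
qed

lemma layer_in_F_sym:
  assumes "0 < n1" "n1 \<le> n" "n < n2" "0 < S"
  shows "layer S n2 n \<in> F_sym n1 n2 n"
proof -
  have "n1\<^sup>2 \<le> n2\<^sup>2"
    using assms by (intro power_mono) auto
  then have "const_outside n (layer S n2 n) (- S) S \<and>
      (AE s in lebesgue. s \<in> {- S<..<S} \<longrightarrow> n1\<^sup>2 \<le> layer S n2 n s \<and> layer S n2 n s \<le> n2\<^sup>2)"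
    using assms by (auto simp: const_outside_def layer_def intro!: AE_I2)
  moreover have "Linf (layer S n2 n)"
    unfolding Linf_def using layer_measurable
    by (auto simp: layer_def intro!: exI[of _ "n2\<^sup>2 + n\<^sup>2"] AE_I2)
  moreover have "AE s in lebesgue. 0 < layer S n2 n s" "AE s in lebesgue. layer S n2 n s = layer S n2 n (- s)"
    using assms by (auto simp: layer_def intro!: AE_I2)
  ultimately show ?thesis
    unfolding F_sym_def by blast
qed

text \<open>
  With \<open>k = \<pi> / 2 - \<i> \<tau>\<close> the condition reads \<open>n\<^sub>2 sinh \<tau> = n cosh \<tau>\<close>, that is,
  \<open>tanh \<tau> = n / n\<^sub>2\<close>.
\<close>

lemma layer_resonance:
  assumes n: "0 < n" "n < n2" and k: "k = of_real (pi / 2) - \<i> * of_real (ln ((n2 + n) / (n2 - n)) / 2)"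
  shows "of_real n2 * cos k = \<i> * of_real n * sin k"
proof -
  define \<tau> q where "\<tau> = ln ((n2 + n) / (n2 - n)) / 2" and "q = exp \<tau>"
  have "q * q = exp (ln ((n2 + n) / (n2 - n)))"
    unfolding q_def \<tau>_def by (simp flip: exp_add)
  then have qq: "q * q = (n2 + n) / (n2 - n)"
    using n by simp
  have q: "0 < q" by (simp add: q_def)
  have "n2 * (q * q - 1) = n * (q * q + 1)"
    unfolding qq using n by (simp add: field_simps)
  then have eq: "n2 * ((q - inverse q) / 2) = n * ((q + inverse q) / 2)"
    using q by (simp add: field_simps)
  have eqi: "exp (of_real \<tau> :: complex) = of_real q"
    by (simp add: q_def exp_of_real)
  have "of_real pi / 2 - k = \<i> * of_real \<tau>"
    unfolding k \<tau>_def by simp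
  then have "cos k = sin (\<i> * of_real \<tau>)" "sin k = cos (\<i> * of_real \<tau>)"
    using cos_sin_eq[of k] sin_cos_eq[of k] by (simp_all only:)
  then have c: "cos k = \<i> * of_real ((q - inverse q) / 2)" and s: "sin k = of_real ((q + inverse q) / 2)"
    by (simp_all add: sin_i_times cos_i_times eqi)
  have "of_real n2 * cos k = \<i> * of_real (n2 * ((q - inverse q) / 2))"
    unfolding c by simp
  also have "\<dots> = \<i> * of_real n * sin k"
    unfolding eq s by simp
  finally show ?thesis .
qed

lemma res_length_layer:
  assumes "0 < n" "n < n2" "0 < S"
  shows "res_length n (layer S n2 n) = 2 * S"
proof -
  have ne: "n2\<^sup>2 \<noteq> n\<^sup>2"
    using assms by (simp add: power2_eq_iff)
  have inside: "S \<le> t" if ae: "AE s in lebesgue. t < s \<longrightarrow> layer S n2 n s = n\<^sup>2" and "- S \<le> t" for t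
  proof (rule ccontr)
    assume "\<not> S \<le> t"
    then obtain s where "t < s" "s < S" "t < s \<longrightarrow> layer S n2 n s = n\<^sup>2"
      using AE_lebesgue_open_ex[OF ae, of t S] by (metis not_le)
    then show False
      using \<open>- S \<le> t\<close> ne by (simp add: layer_def)
  qed
  have nc: "\<not> (AE s in lebesgue. layer S n2 n s = n\<^sup>2)"
  proof
    assume "AE s in lebesgue. layer S n2 n s = n\<^sup>2"
    then have "S \<le> - S"
      by (intro inside) (auto elim: eventually_mono)
    with assms(3) show False by simp
  qed
  have c: "const_outside n (layer S n2 n) (- S) S"
    using assms(3) by (auto simp: const_outside_def layer_def intro!: AE_I2)
  have "AE s in lebesgue. layer S n2 n s = layer S n2 n (- s)"
    by (auto simp: layer_def intro!: AE_I2)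
  then obtain t where t: "shortest_interval n (layer S n2 n) = (- t, t)"
      "const_outside n (layer S n2 n) (- t) t" "t \<le> S"
    using shortest_interval_symmetric[OF c nc] c by blast
  have "S \<le> t"
    using t(2) assms(3) by (intro inside) (auto simp: const_outside_halves)
  with t show ?thesis
    using nc by (simp add: res_length_def)
qed

section \<open>Minimality and uniqueness\<close>

theorem theorem8p4:
  fixes n1 n2 ninf sm sp :: real and \<kappa>0 :: complex and \<epsilon>0 :: "real \<Rightarrow> real"
  assumes "0 < n1" and "n1 < n2"
    and "n1 \<le> ninf" and "ninf < n2"
    and "sp = - sm" and "0 < sp"
    and "\<kappa>0 = - (\<i> / of_real (2 * sp * n2)) * of_real (ln ((n2 + ninf) / (n2 - ninf)))
               + of_real (pi / ((sp - sm) * n2))"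
    and "\<epsilon>0 = (\<lambda>s. if s \<in> {sm..sp} then n2\<^sup>2 else ninf\<^sup>2)"
  shows "is_arg_min (res_length ninf) (\<lambda>\<epsilon>. \<epsilon> \<in> admissible_odd n1 n2 ninf \<kappa>0) \<epsilon>0
    \<and> (\<forall>\<epsilon>. is_arg_min (res_length ninf) (\<lambda>\<epsilon>. \<epsilon> \<in> admissible_odd n1 n2 ninf \<kappa>0) \<epsilon>
          \<longrightarrow> (AE s in lebesgue. \<epsilon> s = \<epsilon>0 s))
    \<and> res_length ninf \<epsilon>0 = 2 * sp
    \<and> L_min_odd n1 n2 ninf \<kappa>0 = ereal (2 * sp)"
proof -
  have n: "0 < ninf" "0 < n2" and sm: "sm = - sp"
    using assms(1-5) by auto
  have \<epsilon>0: "\<epsilon>0 = layer sp n2 ninf"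
    unfolding assms(8) sm by (simp add: layer_def fun_eq_iff)
  define \<tau> where "\<tau> = ln ((n2 + ninf) / (n2 - ninf))"
  have \<tau>: "0 < \<tau>"
    unfolding \<tau>_def using n assms(4) by (intro ln_gt_zero) (simp add: field_simps)
  have \<kappa>: "\<kappa>0 = Complex (pi / (2 * sp * n2)) (- \<tau> / (2 * sp * n2))"
    unfolding assms(7) sm \<tau>_def by (simp add: complex_eq_iff)
  have quadrant: "0 < Re \<kappa>0" "Im \<kappa>0 < 0"
    unfolding \<kappa> using n assms(6) \<tau> by (simp_all add: divide_neg_pos)
  have nz: "\<kappa>0 \<noteq> 0"
    using quadrant by auto
  have "\<kappa>0 * of_real n2 * of_real sp = of_real (pi / 2) - \<i> * of_real (\<tau> / 2)"
    unfolding \<kappa> using n assms(6) by (simp add: complex_eq_iff)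
  then have resonance: "of_real n2 * cos (\<kappa>0 * of_real n2 * of_real sp)
      = \<i> * of_real ninf * sin (\<kappa>0 * of_real n2 * of_real sp)"
    by (intro layer_resonance[OF n(1) assms(4)]) (simp only: \<tau>_def)
  let ?k = "\<kappa>0 * of_real n2"
  let ?Y = "\<lambda>s. sin (?k * of_real s) / ?k" and ?Y' = "\<lambda>s. cos (?k * of_real s)"
  have k: "?k \<noteq> 0" "?k\<^sup>2 = \<kappa>0\<^sup>2 * of_real (n2\<^sup>2)"
    using nz n by (simp_all add: power_mult_distrib)
  have Y: "solves \<kappa>0 (\<lambda>_. n2\<^sup>2) ?Y ?Y'" "?Y 0 = 0" "?Y' 0 = 1"
    using sine_solves[OF k] by simp_all
  have Ysec: "?Y s \<in> sector \<kappa>0" if s: "0 < s" "s < sp" for s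
  proof (rule sine_in_sector[OF quadrant n(2) s(1)])
    have "Re \<kappa>0 * (n2 * s) < Re \<kappa>0 * (n2 * sp)"
      using quadrant n s by simp
    also have "\<dots> = pi / 2"
      unfolding \<kappa> using n assms(6) by simp
    finally show "Re \<kappa>0 * (n2 * s) < pi / 2" .
  qed
  have Ybc: "?Y' sp = (\<i> * \<kappa>0 * of_real ninf) * ?Y sp"
    using resonance nz n by (simp add: field_simps)

  have rigid: "AE s in lebesgue. \<epsilon> s = \<epsilon>0 s"
    if adm: "\<epsilon> \<in> admissible_odd n1 n2 ninf \<kappa>0" and len: "res_length ninf \<epsilon> \<le> 2 * sp" for \<epsilon>
  proof -
    have F: "\<epsilon> \<in> F_sym n1 n2 ninf" and \<Sigma>: "\<kappa>0 \<in> Sigma_odd ninf \<epsilon>"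
      using adm by (auto simp: admissible_odd_def)
    have out: "const_outside ninf \<epsilon> (- sp) sp"
      by (rule short_imp_const_outside[OF F len assms(6)])
    have meas: "\<epsilon> \<in> borel_measurable lebesgue" and sym: "AE s in lebesgue. \<epsilon> s = \<epsilon> (- s)"
      using F by (auto simp: F_sym_def Linf_def)
    note bounds = F_sym_bounds[OF assms(1,3,4) F]
    have "AE s in lebesgue. \<bar>\<epsilon> s\<bar> \<le> n2\<^sup>2"
      using bounds by eventually_elim (use zero_le_power2[of n1] in linarith)
    then obtain y y' where y: "solves \<kappa>0 \<epsilon> y y'" "y 0 = 0" "y' 0 = 1"
      and ybc: "y' sp = (\<i> * \<kappa>0 * of_real ninf) * y sp"
      using Sigma_odd_normalized_solution[OF \<Sigma> meas _ out] by blast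
    have n12: "0 < n1\<^sup>2" "n1\<^sup>2 \<le> n2\<^sup>2"
      using assms(1,2) by (auto intro!: power_mono)
    have right: "AE s in lebesgue. s \<in> {0..sp} \<longrightarrow> \<epsilon> s = n2\<^sup>2"
      by (rule matching_solutions_imp_coefficient_eq[OF quadrant y Y n12(1) bounds n12(2) Ysec assms(6) ybc Ybc])
    have "AE s in lebesgue. s \<notin> {- sp..sp} \<longrightarrow> \<epsilon> s = ninf\<^sup>2"
      using out by (simp add: const_outside_def)
    then show ?thesis
      using right AE_lebesgue_reflect[OF right] sym
    proof eventually_elim
      case (elim s)
      then show ?case
        by (cases "0 \<le> s") (auto simp: \<epsilon>0 layer_def)
    qed
  qed
  have adm0: "\<epsilon>0 \<in> admissible_odd n1 n2 ninf \<kappa>0"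
    unfolding admissible_odd_def \<epsilon>0
    using layer_in_F_sym[OF assms(1,3,4,6)] layer_in_Sigma_odd[OF nz assms(6) n(2) resonance] by simp
  have len0: "res_length ninf \<epsilon>0 = 2 * sp"
    unfolding \<epsilon>0 by (rule res_length_layer[OF n(1) assms(4,6)])
  have lower: "2 * sp \<le> res_length ninf \<epsilon>" if "\<epsilon> \<in> admissible_odd n1 n2 ninf \<kappa>0" for \<epsilon>
  proof (cases "res_length ninf \<epsilon> \<le> 2 * sp")
    case True
    then show ?thesis
      using res_length_cong_AE[OF rigid[OF that True]] len0 by simp
  qed simp
  have "is_arg_min (res_length ninf) (\<lambda>\<epsilon>. \<epsilon> \<in> admissible_odd n1 n2 ninf \<kappa>0) \<epsilon>0"
    unfolding is_arg_min_linorder using adm0 lower len0 by simp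
  moreover have "AE s in lebesgue. \<epsilon> s = \<epsilon>0 s"
    if "is_arg_min (res_length ninf) (\<lambda>\<epsilon>. \<epsilon> \<in> admissible_odd n1 n2 ninf \<kappa>0) \<epsilon>" for \<epsilon>
    using that adm0 len0 unfolding is_arg_min_linorder by (intro rigid) auto
  moreover have "L_min_odd n1 n2 ninf \<kappa>0 = ereal (2 * sp)"
    unfolding L_min_odd_def
  proof (rule antisym)
    show "(INF \<epsilon>\<in>admissible_odd n1 n2 ninf \<kappa>0. ereal (res_length ninf \<epsilon>)) \<le> ereal (2 * sp)"
      using INF_lower[OF adm0, of "\<lambda>\<epsilon>. ereal (res_length ninf \<epsilon>)"] len0 by simp
    show "ereal (2 * sp) \<le> (INF \<epsilon>\<in>admissible_odd n1 n2 ninf \<kappa>0. ereal (res_length ninf \<epsilon>))"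
      using lower by (intro INF_greatest) simp
  qed
  ultimately show ?thesis
    using len0 by blast
qed

end
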